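(* Let $\sigma$ be a signature. For all sets $\Gamma\subseteq\mathrm{Sent}_\sigma$ and $\Delta\subseteq\mathrm{Form}_\sigma$: $\Gamma\vdash\Delta$ if and only if $\Gamma\vDash\Delta$.
   Context: Syntax. A signature $\sigma$ is a set of predicate symbols (each with an arity) and constant symbols; there are no function symbols. $\mathrm{Var}$ is a fixed countable set of variables; the $\sigma$-terms are the variables and the constants of $\sigma$. The $\sigma$-formulas (set $\mathrm{Form}_\sigma$) are built from atomic formulas $P(t_1,\dots,t_n)$ and the constant $\bot$ using the binary connectives $\rightarrow,\wedge,\vee$, the unary strong negation $\sim$, the modal operators $\Box,\Diamond$ and the quantifiers $\forall x,\exists x$. $\mathrm{Sent}_\sigma$ is the set of $\sigma$-sentences (no free variables). Abbreviations: $\neg\Phi:=\Phi\rightarrow\bot$, $\Phi\leftrightarrow\Psi:=(\Phi\rightarrow\Psi)\wedge(\Psi\rightarrow\Phi)$, $\Phi\Leftrightarrow\Psi:=(\Phi\leftrightarrow\Psi)\wedge({\sim\Phi}\leftrightarrow{\sim\Psi})$. $\Phi(x/t)$ denotes the result of substituting the term $t$ for the free occurrences of $x$ in $\Phi$. Calculus. $\mathsf{QBK}_\sigma$ is the smallest set of $\sigma$-formulas containing all instances of the following axiom schemes and closed under the rules below. Axioms: $\Phi\rightarrow(\Psi\rightarrow\Phi)$; $(\Phi\rightarrow(\Psi\rightarrow\Theta))\rightarrow((\Phi\rightarrow\Psi)\rightarrow(\Phi\rightarrow\Theta))$; $\Phi\wedge\Psi\rightarrow\Phi$; $\Phi\wedge\Psi\rightarrow\Psi$;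 $\Phi\rightarrow(\Psi\rightarrow\Phi\wedge\Psi)$; $\Phi\rightarrow\Phi\vee\Psi$; $\Psi\rightarrow\Phi\vee\Psi$; $(\Phi\rightarrow\Theta)\rightarrow((\Psi\rightarrow\Theta)\rightarrow(\Phi\vee\Psi\rightarrow\Theta))$; $\Phi\vee(\Phi\rightarrow\bot)$; $\bot\rightarrow\Phi$; ${\sim\sim\Phi}\leftrightarrow\Phi$; ${\sim(\Phi\rightarrow\Psi)}\leftrightarrow(\Phi\wedge{\sim\Psi})$; ${\sim(\Phi\vee\Psi)}\leftrightarrow({\sim\Phi}\wedge{\sim\Psi})$; ${\sim(\Phi\wedge\Psi)}\leftrightarrow({\sim\Phi}\vee{\sim\Psi})$; ${\sim\bot}$; $(\Box\Phi\wedge\Box\Psi)\rightarrow\Box(\Phi\wedge\Psi)$; $\Box(\Phi\rightarrow\Phi)$; $\neg\Box\Phi\leftrightarrow\Diamond\neg\Phi$; $\neg\Diamond\Phi\leftrightarrow\Box\neg\Phi$; $\Box\Phi\Leftrightarrow{\sim\Diamond{\sim\Phi}}$; $\Diamond\Phi\Leftrightarrow{\sim\Box{\sim\Phi}}$; $\forall x\Phi\rightarrow\Phi(x/t)$ and $\Phi(x/t)\rightarrow\exists x\Phi$ ($t$ free for $x$ in $\Phi$); ${\sim\forall x\Phi}\leftrightarrow\exists x{\sim\Phi}$; ${\sim\exists x\Phi}\leftrightarrow\forall x{\sim\Phi}$. Rules: MP: from $\Phi$ and $\Phi\rightarrow\Psi$ infer $\Psi$; MB: from $\Phi\rightarrow\Psi$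 infer $\Box\Phi\rightarrow\Box\Psi$; MD: from $\Phi\rightarrow\Psi$ infer $\Diamond\Phi\rightarrow\Diamond\Psi$; BR1: from $\Phi\rightarrow\Psi$ infer $\Phi\rightarrow\forall x\Psi$ if $x$ is not free in $\Phi$; BR2: from $\Phi\rightarrow\Psi$ infer $\exists x\Phi\rightarrow\Psi$ if $x$ is not free in $\Psi$. Derivability. For $\Delta\subseteq\mathrm{Form}_\sigma$, $\mathrm{Disj}(\Delta)$ is the set of disjunctions $\Phi_1\vee\dots\vee\Phi_n$ with $\{\Phi_1,\dots,\Phi_n\}\subseteq\Delta$, $n\ge 0$ (the empty disjunction is $\bot$). For $\Gamma\subseteq\mathrm{Sent}_\sigma$, $\Delta\subseteq\mathrm{Form}_\sigma$: $\Gamma\vdash\Delta$ iff some element of $\mathrm{Disj}(\Delta)$ can be obtained from elements of $\Gamma\cup\mathsf{QBK}_\sigma$ using only MP, BR1, BR2. Semantics. A $\mathsf{QBK}_\sigma$-model is $\mathcal M=\langle\langle W,R\rangle,(\mathfrak A^+_w)_{w\in W},(\mathfrak A^-_w)_{w\in W}\rangle$ with $W\neq\emptyset$, $R\subseteq W\times W$, where for each $w$, $\mathfrak A^+_w,\mathfrak A^-_w$ are $\sigma$-structures with a common domain $A_w$ and the same interpretation of constants, and whenever $uRv$: $A_u\subseteq A_v$ and each constant of $\sigma$ has the same interpretation in $\mathfrak A^+_u$ and $\mathfrak A^+_v$. For a set $A$, $\sigma_A$ is $\sigma$ extended by new constants $\underline a$ ($a\in A$), interpreted as $a$; $A$-sentences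 are $\sigma_A$-sentences; an $A$-substitution is a map $\lambda:\mathrm{Var}\to$ $\sigma_A$-terms, ground if all values are constants; $\lambda\Phi$ is the simultaneous substitution of $\lambda(x)$ for the free occurrences of each $x$. Verification $\Vdash^+$ and falsification $\Vdash^-$ of an $A_w$-sentence at $w$: atomic $\Theta$: $\mathcal M,w\Vdash^+\Theta$ iff $\mathfrak A^+_w\models\Theta$, $\mathcal M,w\Vdash^-\Theta$ iff $\mathfrak A^-_w\models\Theta$; $\bot$ is never verified and always falsified; $\Phi\wedge\Psi$: verified iff both are verified, falsified iff at least one is falsified; $\Phi\vee\Psi$: verified iff at least one is verified, falsified iff both are falsified; $\Phi\rightarrow\Psi$: verified iff $\Phi$ is not verified or $\Psi$ is verified, falsified iff $\Phi$ is verified and $\Psi$ is falsified; ${\sim\Phi}$: verified iff $\Phi$ falsified, falsified iff $\Phi$ verified; $\Box\Phi$: verified at $w$ iff $\Phi$ is verified at every $u$ with $wRu$, falsified iff $\Phi$ is falsified at some $u$ with $wRu$; $\Diamond\Phi$: verified iff $\Phi$ is verified at some $u$ with $wRu$, falsified iff $\Phi$ is falsified at every $u$ with $wRu$; $\forall x\Phi$: verified iff $\Phi(x/\underline a)$ is verified for all $a\in A_w$, falsified iff $\Phi(x/\underline a)$ is falsified for some $a\in A_w$; $\exists x\Phi$: verified iff $\Phi(x/\underline a)$ verified for some $a\in A_w$, falsified iff $\Phi(x/\underline a)$ falsified for all $a\in A_w$. For $\Gamma\subseteq\mathrm{Sent}_\sigma$, $\Delta\subseteq\mathrm{Form}_\sigma$: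 $\Gamma\vDash\Delta$ iff for every $\mathsf{QBK}_\sigma$-model $\mathcal M$, every world $w$ and every ground $A_w$-substitution $\lambda$: if $\mathcal M,w\Vdash^+\Phi$ for all $\Phi\in\Gamma$, then $\mathcal M,w\Vdash^+\lambda\Psi$ for some $\Psi\in\Delta$. *)

theory Defs
  imports Main
begin

section \<open>Syntax\<close>

record ('p, 'c) signature =
  preds :: "'p set"
  arity :: "'p \<Rightarrow> nat"
  csts :: "'c set"

datatype 'c tm = Var nat | Cst 'c

datatype ('p, 'c) fm =
    Atom 'p "'c tm list"
  | Bot
  | Imp "('p, 'c) fm" "('p, 'c) fm"
  | And "('p, 'c) fm" "('p, 'c) fm"
  | Or "('p, 'c) fm" "('p, 'c) fm"
  | SNeg "('p, 'c) fm"
  | Box "('p, 'c) fm"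
  | Dia "('p, 'c) fm"
  | Forall nat "('p, 'c) fm"
  | Exists nat "('p, 'c) fm"

abbreviation Neg :: "('p, 'c) fm \<Rightarrow> ('p, 'c) fm" where
  "Neg F \<equiv> Imp F Bot"

abbreviation Iff :: "('p, 'c) fm \<Rightarrow> ('p, 'c) fm \<Rightarrow> ('p, 'c) fm" where
  "Iff F G \<equiv> And (Imp F G) (Imp G F)"

abbreviation SIff :: "('p, 'c) fm \<Rightarrow> ('p, 'c) fm \<Rightarrow> ('p, 'c) fm" where
  "SIff F G \<equiv> And (Iff F G) (Iff (SNeg F) (SNeg G))"

definition Tm :: "('p, 'c) signature \<Rightarrow> 'c tm set" where
  "Tm \<sigma> = range Var \<union> Cst ` csts \<sigma>"

primrec wf_fm :: "('p, 'c) signature \<Rightarrow> ('p, 'c) fm \<Rightarrow> bool" where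
  "wf_fm \<sigma> (Atom P ts) \<longleftrightarrow> P \<in> preds \<sigma> \<and> length ts = arity \<sigma> P \<and> set ts \<subseteq> Tm \<sigma>"
| "wf_fm \<sigma> Bot \<longleftrightarrow> True"
| "wf_fm \<sigma> (Imp F G) \<longleftrightarrow> wf_fm \<sigma> F \<and> wf_fm \<sigma> G"
| "wf_fm \<sigma> (And F G) \<longleftrightarrow> wf_fm \<sigma> F \<and> wf_fm \<sigma> G"
| "wf_fm \<sigma> (Or F G) \<longleftrightarrow> wf_fm \<sigma> F \<and> wf_fm \<sigma> G"
| "wf_fm \<sigma> (SNeg F) \<longleftrightarrow> wf_fm \<sigma> F"
| "wf_fm \<sigma> (Box F) \<longleftrightarrow> wf_fm \<sigma> F"
| "wf_fm \<sigma> (Dia F) \<longleftrightarrow> wf_fm \<sigma> F"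
| "wf_fm \<sigma> (Forall x F) \<longleftrightarrow> wf_fm \<sigma> F"
| "wf_fm \<sigma> (Exists x F) \<longleftrightarrow> wf_fm \<sigma> F"

primrec fv_tm :: "'c tm \<Rightarrow> nat set" where
  "fv_tm (Var x) = {x}"
| "fv_tm (Cst c) = {}"

primrec fv :: "('p, 'c) fm \<Rightarrow> nat set" where
  "fv (Atom P ts) = (\<Union>t\<in>set ts. fv_tm t)"
| "fv Bot = {}"
| "fv (Imp F G) = fv F \<union> fv G"
| "fv (And F G) = fv F \<union> fv G"
| "fv (Or F G) = fv F \<union> fv G"
| "fv (SNeg F) = fv F"
| "fv (Box F) = fv F"
| "fv (Dia F) = fv F"
| "fv (Forall x F) = fv F - {x}"
| "fv (Exists x F) = fv F - {x}"

definition Form :: "('p, 'c) signature \<Rightarrow> ('p, 'c) fm set" where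
  "Form \<sigma> = {F. wf_fm \<sigma> F}"

definition Sent :: "('p, 'c) signature \<Rightarrow> ('p, 'c) fm set" where
  "Sent \<sigma> = {F \<in> Form \<sigma>. fv F = {}}"

primrec subst_tm :: "(nat \<Rightarrow> 'c tm) \<Rightarrow> 'c tm \<Rightarrow> 'c tm" where
  "subst_tm s (Var x) = s x"
| "subst_tm s (Cst c) = Cst c"

text \<open>Simultaneous substitution for the free occurrences of variables. Bound variables are never
  renamed, so capture has to be excluded by a side condition.\<close>

primrec subst :: "(nat \<Rightarrow> 'c tm) \<Rightarrow> ('p, 'c) fm \<Rightarrow> ('p, 'c) fm" where
  "subst s (Atom P ts) = Atom P (map (subst_tm s) ts)"
| "subst s Bot = Bot"
| "subst s (Imp F G) = Imp (subst s F) (subst s G)"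
| "subst s (And F G) = And (subst s F) (subst s G)"
| "subst s (Or F G) = Or (subst s F) (subst s G)"
| "subst s (SNeg F) = SNeg (subst s F)"
| "subst s (Box F) = Box (subst s F)"
| "subst s (Dia F) = Dia (subst s F)"
| "subst s (Forall x F) = Forall x (subst (s(x := Var x)) F)"
| "subst s (Exists x F) = Exists x (subst (s(x := Var x)) F)"

definition subst1 :: "nat \<Rightarrow> 'c tm \<Rightarrow> ('p, 'c) fm \<Rightarrow> ('p, 'c) fm" where
  "subst1 x t F = subst (Var(x := t)) F"

primrec free_for :: "'c tm \<Rightarrow> nat \<Rightarrow> ('p, 'c) fm \<Rightarrow> bool" where
  "free_for t x (Atom P ts) \<longleftrightarrow> True"
| "free_for t x Bot \<longleftrightarrow> True"
| "free_for t x (Imp F G) \<longleftrightarrow> free_for t x F \<and> free_for t x G"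
| "free_for t x (And F G) \<longleftrightarrow> free_for t x F \<and> free_for t x G"
| "free_for t x (Or F G) \<longleftrightarrow> free_for t x F \<and> free_for t x G"
| "free_for t x (SNeg F) \<longleftrightarrow> free_for t x F"
| "free_for t x (Box F) \<longleftrightarrow> free_for t x F"
| "free_for t x (Dia F) \<longleftrightarrow> free_for t x F"
| "free_for t x (Forall y F) \<longleftrightarrow> x \<notin> fv (Forall y F) \<or> (y \<notin> fv_tm t \<and> free_for t x F)"
| "free_for t x (Exists y F) \<longleftrightarrow> x \<notin> fv (Exists y F) \<or> (y \<notin> fv_tm t \<and> free_for t x F)"

section \<open>Calculus\<close>

inductive axiom :: "('p, 'c) fm \<Rightarrow> bool" where
  "axiom (Imp F (Imp G F))"
| "axiom (Imp (Imp F (Imp G H)) (Imp (Imp F G) (Imp F H)))"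
| "axiom (Imp (And F G) F)"
| "axiom (Imp (And F G) G)"
| "axiom (Imp F (Imp G (And F G)))"
| "axiom (Imp F (Or F G))"
| "axiom (Imp G (Or F G))"
| "axiom (Imp (Imp F H) (Imp (Imp G H) (Imp (Or F G) H)))"
| "axiom (Or F (Imp F Bot))"
| "axiom (Imp Bot F)"
| "axiom (Iff (SNeg (SNeg F)) F)"
| "axiom (Iff (SNeg (Imp F G)) (And F (SNeg G)))"
| "axiom (Iff (SNeg (Or F G)) (And (SNeg F) (SNeg G)))"
| "axiom (Iff (SNeg (And F G)) (Or (SNeg F) (SNeg G)))"
| "axiom (SNeg Bot)"
| "axiom (Imp (And (Box F) (Box G)) (Box (And F G)))"
| "axiom (Box (Imp F F))"
| "axiom (Iff (Neg (Box F)) (Dia (Neg F)))"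
| "axiom (Iff (Neg (Dia F)) (Box (Neg F)))"
| "axiom (SIff (Box F) (SNeg (Dia (SNeg F))))"
| "axiom (SIff (Dia F) (SNeg (Box (SNeg F))))"
| "free_for t x F \<Longrightarrow> axiom (Imp (Forall x F) (subst1 x t F))"
| "free_for t x F \<Longrightarrow> axiom (Imp (subst1 x t F) (Exists x F))"
| "axiom (Iff (SNeg (Forall x F)) (Exists x (SNeg F)))"
| "axiom (Iff (SNeg (Exists x F)) (Forall x (SNeg F)))"

inductive_set QBK :: "('p, 'c) signature \<Rightarrow> ('p, 'c) fm set" for \<sigma> :: "('p, 'c) signature" where
  Ax: "axiom F \<Longrightarrow> F \<in> Form \<sigma> \<Longrightarrow> F \<in> QBK \<sigma>"
| MP: "F \<in> QBK \<sigma> \<Longrightarrow> Imp F G \<in> QBK \<sigma> \<Longrightarrow> G \<in> QBK \<sigma>"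
| MB: "Imp F G \<in> QBK \<sigma> \<Longrightarrow> Imp (Box F) (Box G) \<in> QBK \<sigma>"
| MD: "Imp F G \<in> QBK \<sigma> \<Longrightarrow> Imp (Dia F) (Dia G) \<in> QBK \<sigma>"
| BR1: "Imp F G \<in> QBK \<sigma> \<Longrightarrow> x \<notin> fv F \<Longrightarrow> Imp F (Forall x G) \<in> QBK \<sigma>"
| BR2: "Imp F G \<in> QBK \<sigma> \<Longrightarrow> x \<notin> fv G \<Longrightarrow> Imp (Exists x F) G \<in> QBK \<sigma>"

inductive_set consequences :: "('p, 'c) signature \<Rightarrow> ('p, 'c) fm set \<Rightarrow> ('p, 'c) fm set"
  for \<sigma> :: "('p, 'c) signature" and \<Gamma> :: "('p, 'c) fm set" where
  base: "F \<in> \<Gamma> \<union> QBK \<sigma> \<Longrightarrow> F \<in> consequences \<sigma> \<Gamma>"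
| MP: "F \<in> consequences \<sigma> \<Gamma> \<Longrightarrow> Imp F G \<in> consequences \<sigma> \<Gamma> \<Longrightarrow> G \<in> consequences \<sigma> \<Gamma>"
| BR1: "Imp F G \<in> consequences \<sigma> \<Gamma> \<Longrightarrow> x \<notin> fv F \<Longrightarrow> Imp F (Forall x G) \<in> consequences \<sigma> \<Gamma>"
| BR2: "Imp F G \<in> consequences \<sigma> \<Gamma> \<Longrightarrow> x \<notin> fv G \<Longrightarrow> Imp (Exists x F) G \<in> consequences \<sigma> \<Gamma>"

fun disjunction :: "('p, 'c) fm list \<Rightarrow> ('p, 'c) fm" where
  "disjunction [] = Bot"
| "disjunction [F] = F"
| "disjunction (F # G # Fs) = Or F (disjunction (G # Fs))"

definition Disj :: "('p, 'c) fm set \<Rightarrow> ('p, 'c) fm set" where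
  "Disj \<Delta> = {disjunction Fs | Fs. set Fs \<subseteq> \<Delta>}"

definition derives :: "('p, 'c) signature \<Rightarrow> ('p, 'c) fm set \<Rightarrow> ('p, 'c) fm set \<Rightarrow> bool" where
  "derives \<sigma> \<Gamma> \<Delta> \<longleftrightarrow> (\<exists>F \<in> Disj \<Delta>. F \<in> consequences \<sigma> \<Gamma>)"

section \<open>Semantics\<close>

record ('p, 'c, 'a) struct =
  carr :: "'a set"
  cint :: "'c \<Rightarrow> 'a"
  pint :: "'p \<Rightarrow> 'a list set"

definition is_struct :: "('p, 'c) signature \<Rightarrow> ('p, 'c, 'a) struct \<Rightarrow> bool" where
  "is_struct \<sigma> \<AA> \<longleftrightarrow>
     carr \<AA> \<noteq> {} \<and>
     (\<forall>c \<in> csts \<sigma>. cint \<AA> c \<in> carr \<AA>) \<and>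
     (\<forall>P \<in> preds \<sigma>. pint \<AA> P \<subseteq> {as. length as = arity \<sigma> P \<and> set as \<subseteq> carr \<AA>})"

record ('p, 'c, 'a, 'w) model =
  worlds :: "'w set"
  acc :: "('w \<times> 'w) set"
  pos :: "'w \<Rightarrow> ('p, 'c, 'a) struct"
  neg :: "'w \<Rightarrow> ('p, 'c, 'a) struct"

definition is_model :: "('p, 'c) signature \<Rightarrow> ('p, 'c, 'a, 'w) model \<Rightarrow> bool" where
  "is_model \<sigma> M \<longleftrightarrow>
     worlds M \<noteq> {} \<and>
     acc M \<subseteq> worlds M \<times> worlds M \<and>
     (\<forall>w \<in> worlds M.
        is_struct \<sigma> (pos M w) \<and> is_struct \<sigma> (neg M w) \<and>
        carr (pos M w) = carr (neg M w) \<and>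
        (\<forall>c \<in> csts \<sigma>. cint (pos M w) c = cint (neg M w) c)) \<and>
     (\<forall>(u, v) \<in> acc M.
        carr (pos M u) \<subseteq> carr (pos M v) \<and>
        (\<forall>c \<in> csts \<sigma>. cint (pos M u) c = cint (pos M v) c))"

text \<open>In the extended signature \<open>Inl c\<close> is the constant \<open>c\<close> of \<open>\<sigma>\<close> and \<open>Inr a\<close> is the new
  constant naming the element \<open>a\<close>; \<open>lift\<close> is the inclusion of the \<open>\<sigma>\<close>-formulas into the formulas
  of the extended signature.\<close>

definition sig_ext :: "('p, 'c) signature \<Rightarrow> 'a set \<Rightarrow> ('p, 'c + 'a) signature" where
  "sig_ext \<sigma> A = \<lparr>preds = preds \<sigma>, arity = arity \<sigma>, csts = Inl ` csts \<sigma> \<union> Inr ` A\<rparr>"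

definition lift :: "('p, 'c) fm \<Rightarrow> ('p, 'c + 'a) fm" where
  "lift = map_fm id Inl"

definition is_subst :: "('p, 'c) signature \<Rightarrow> 'a set \<Rightarrow> (nat \<Rightarrow> ('c + 'a) tm) \<Rightarrow> bool" where
  "is_subst \<sigma> A s \<longleftrightarrow> (\<forall>x. s x \<in> Tm (sig_ext \<sigma> A))"

definition ground :: "(nat \<Rightarrow> 'c tm) \<Rightarrow> bool" where
  "ground s \<longleftrightarrow> (\<forall>x. \<exists>c. s x = Cst c)"

text \<open>Only closed terms are ever evaluated; the value of a variable is left unspecified.\<close>

fun tm_val :: "('p, 'c, 'a) struct \<Rightarrow> ('c + 'a) tm \<Rightarrow> 'a" where
  "tm_val \<AA> (Cst (Inl c)) = cint \<AA> c"
| "tm_val \<AA> (Cst (Inr a)) = a"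
| "tm_val \<AA> (Var x) = undefined"

lemma size_subst [simp]: "size (subst s F) = size F"
proof (induction F arbitrary: s)
  case (Atom P ts)
  have "size (subst_tm s t) = size t" for t
    by (cases t; cases "subst_tm s t") simp_all
  then show ?case
    by (simp add: comp_def)
qed simp_all

text \<open>\<open>verifies M w F\<close> and \<open>falsifies M w F\<close> are meant for sentences \<open>F\<close> of \<open>\<sigma>\<close> extended by the
  elements of the domain of \<open>w\<close>.\<close>

function (sequential)
  verifies :: "('p, 'c, 'a, 'w) model \<Rightarrow> 'w \<Rightarrow> ('p, 'c + 'a) fm \<Rightarrow> bool" and
  falsifies :: "('p, 'c, 'a, 'w) model \<Rightarrow> 'w \<Rightarrow> ('p, 'c + 'a) fm \<Rightarrow> bool"
where
  "verifies M w (Atom P ts) \<longleftrightarrow> map (tm_val (pos M w)) ts \<in> pint (pos M w) P"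
| "verifies M w Bot \<longleftrightarrow> False"
| "verifies M w (Imp F G) \<longleftrightarrow> \<not> verifies M w F \<or> verifies M w G"
| "verifies M w (And F G) \<longleftrightarrow> verifies M w F \<and> verifies M w G"
| "verifies M w (Or F G) \<longleftrightarrow> verifies M w F \<or> verifies M w G"
| "verifies M w (SNeg F) \<longleftrightarrow> falsifies M w F"
| "verifies M w (Box F) \<longleftrightarrow> (\<forall>u. (w, u) \<in> acc M \<longrightarrow> verifies M u F)"
| "verifies M w (Dia F) \<longleftrightarrow> (\<exists>u. (w, u) \<in> acc M \<and> verifies M u F)"
| "verifies M w (Forall x F) \<longleftrightarrow> (\<forall>a \<in> carr (pos M w). verifies M w (subst1 x (Cst (Inr a)) F))"
| "verifies M w (Exists x F) \<longleftrightarrow> (\<exists>a \<in> carr (pos M w). verifies M w (subst1 x (Cst (Inr a)) F))"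
| "falsifies M w (Atom P ts) \<longleftrightarrow> map (tm_val (neg M w)) ts \<in> pint (neg M w) P"
| "falsifies M w Bot \<longleftrightarrow> True"
| "falsifies M w (Imp F G) \<longleftrightarrow> verifies M w F \<and> falsifies M w G"
| "falsifies M w (And F G) \<longleftrightarrow> falsifies M w F \<or> falsifies M w G"
| "falsifies M w (Or F G) \<longleftrightarrow> falsifies M w F \<and> falsifies M w G"
| "falsifies M w (SNeg F) \<longleftrightarrow> verifies M w F"
| "falsifies M w (Box F) \<longleftrightarrow> (\<exists>u. (w, u) \<in> acc M \<and> falsifies M u F)"
| "falsifies M w (Dia F) \<longleftrightarrow> (\<forall>u. (w, u) \<in> acc M \<longrightarrow> falsifies M u F)"
| "falsifies M w (Forall x F) \<longleftrightarrow> (\<exists>a \<in> carr (pos M w). falsifies M w (subst1 x (Cst (Inr a)) F))"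
| "falsifies M w (Exists x F) \<longleftrightarrow> (\<forall>a \<in> carr (pos M w). falsifies M w (subst1 x (Cst (Inr a)) F))"
  by pat_completeness auto
termination
  by (relation "measure (\<lambda>z. case z of Inl (M, w, F) \<Rightarrow> size F | Inr (M, w, F) \<Rightarrow> size F)")
     (auto simp: subst1_def)

text \<open>HOL cannot quantify over types inside a formula, so the consequence relation is relative to
  the type \<open>'a\<close> of individuals and the type \<open>'w\<close> of worlds. Soundness is to hold for arbitrary
  \<open>'a\<close> and \<open>'w\<close>; for completeness it suffices that \<open>'a\<close> and \<open>'w\<close> are large enough to carry a canonical
  model, for instance formulas as individuals and sets of formulas as worlds.\<close>

definition entails ::
  "'a itself \<Rightarrow> 'w itself \<Rightarrow> ('p, 'c) signature \<Rightarrow> ('p, 'c) fm set \<Rightarrow> ('p, 'c) fm set \<Rightarrow> bool"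
where
  "entails _ _ \<sigma> \<Gamma> \<Delta> \<longleftrightarrow>
     (\<forall>(M :: ('p, 'c, 'a, 'w) model) w s.
        is_model \<sigma> M \<longrightarrow> w \<in> worlds M \<longrightarrow> is_subst \<sigma> (carr (pos M w)) s \<longrightarrow> ground s \<longrightarrow>
        (\<forall>F \<in> \<Gamma>. verifies M w (lift F)) \<longrightarrow>
        (\<exists>G \<in> \<Delta>. verifies M w (subst s (lift G))))"

end

theory Submission
  imports Defs
begin

text \<open>Completeness is a Henkin argument adapted to increasing domains. Worlds are pairs \<open>(n, w)\<close> of a
  level and a maximal consistent set that has witnesses for all its existential sentences among the
  constants of level at most \<open>n + 1\<close>; accessibility goes from level \<open>n\<close> to level \<open>n + 1\<close> only, so the
  witnesses of a successor are fresh with respect to the sentences inherited from its predecessor.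
  The witnesses form a datatype nested through formulas, and the Henkin axioms are conservative
  because the witness of largest size among finitely many of them occurs in none of the others.
  Strong negation needs no extra idea: the truth lemma is proved simultaneously for \<open>F\<close> and \<open>SNeg F\<close>.
  Provability of a formula in the extended language goes back to the original one by replacing
  constants with variables that exceed all variables of the derivation and ill-formed atoms with
  \<open>Bot\<close>. Finally constants and theories over them are coded injectively as formulas and sets of
  formulas of the original signature.\<close>

section \<open>Substitution\<close>

text \<open>Bound variables count as well: substitution never renames, and a variable that occurs
  nowhere is certain not to be captured.\<close>

primrec all_vars :: "('p, 'c) fm \<Rightarrow> nat set" where
  "all_vars (Atom P ts) = (\<Union>t\<in>set ts. fv_tm t)"
| "all_vars Bot = {}"
| "all_vars (Imp F G) = all_vars F \<union> all_vars G"
| "all_vars (And F G) = all_vars F \<union> all_vars G"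
| "all_vars (Or F G) = all_vars F \<union> all_vars G"
| "all_vars (SNeg F) = all_vars F"
| "all_vars (Box F) = all_vars F"
| "all_vars (Dia F) = all_vars F"
| "all_vars (Forall x F) = insert x (all_vars F)"
| "all_vars (Exists x F) = insert x (all_vars F)"

lemma finite_fv_tm [simp]: "finite (fv_tm t)"
  by (cases t) auto

lemma finite_all_vars [simp]: "finite (all_vars F)"
  by (induction F) auto

lemma fv_subset_all_vars: "fv F \<subseteq> all_vars F"
  by (induction F) auto

lemma finite_fv: "finite (fv F)"
  using finite_subset[OF fv_subset_all_vars] by simp

lemma subst_tm_Var [simp]: "subst_tm Var t = t"
  by (cases t) auto

lemma subst_tm_cong: "(\<And>x. x \<in> fv_tm t \<Longrightarrow> s x = s' x) \<Longrightarrow> subst_tm s t = subst_tm s' t"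
  by (cases t) auto

lemma subst_cong: "(\<And>x. x \<in> fv F \<Longrightarrow> s x = s' x) \<Longrightarrow> subst s F = subst s' F"
proof (induction F arbitrary: s s')
  case (Atom P ts)
  then show ?case by (auto intro!: subst_tm_cong)
next
  case (Forall x F)
  have "subst (s(x := Var x)) F = subst (s'(x := Var x)) F"
    by (rule Forall.IH) (use Forall.prems in auto)
  then show ?case by simp
next
  case (Exists x F)
  have "subst (s(x := Var x)) F = subst (s'(x := Var x)) F"
    by (rule Exists.IH) (use Exists.prems in auto)
  then show ?case by simp
next
  case (Imp F G)
  show ?case using Imp.IH[of s s'] Imp.prems by simp
next
  case (And F G)
  show ?case using And.IH[of s s'] And.prems by simp
next
  case (Or F G)
  show ?case using Or.IH[of s s'] Or.prems by simp
next
  case (SNeg F)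
  show ?case using SNeg.IH[of s s'] SNeg.prems by simp
next
  case (Box F)
  show ?case using Box.IH[of s s'] Box.prems by simp
next
  case (Dia F)
  show ?case using Dia.IH[of s s'] Dia.prems by simp
qed simp

lemma subst_Var [simp]: "subst Var F = F"
  by (induction F) (simp_all add: map_idI fun_upd_idem)

lemma subst_closed: "fv F = {} \<Longrightarrow> subst s F = F"
  using subst_cong[of F s Var] by simp

lemma subst1_not_free: "x \<notin> fv F \<Longrightarrow> subst1 x t F = F"
  unfolding subst1_def by (subst subst_cong[of F _ Var]) auto

lemma subst1_Var_same [simp]: "subst1 x (Var x) F = F"
  by (simp add: subst1_def fun_upd_idem)

lemma subst1_simps [simp]:
  "subst1 x t Bot = Bot"
  "subst1 x t (Imp F G) = Imp (subst1 x t F) (subst1 x t G)"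
  "subst1 x t (SNeg F) = SNeg (subst1 x t F)"
  by (simp_all add: subst1_def)

lemma free_for_Var_same: "free_for (Var x) x F"
  by (induction F) auto

lemma free_for_closed: "fv_tm t = {} \<Longrightarrow> free_for t x F"
  by (induction F) auto

text \<open>No value of \<open>s\<close> brings in a variable other than its own. Below a quantifier
  on \<open>x\<close> the other values are therefore free of \<open>x\<close>, and \<open>s'\<close>
  acts on them just as \<open>s'(x := Var x)\<close> does.\<close>

lemma subst_subst:
  "(\<And>x. s x = Var x \<or> fv_tm (s x) = {}) \<Longrightarrow> subst s' (subst s F) = subst (\<lambda>x. subst_tm s' (s x)) F"
proof (induction F arbitrary: s s')
  case (Atom P ts)
  have "subst_tm s' (subst_tm s t) = subst_tm (\<lambda>x. subst_tm s' (s x)) t" for t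
    by (cases t) auto
  then show ?case by simp
next
  case (Forall x F)
  have "subst_tm (s'(x := Var x)) (s y) = subst_tm s' (s y)" if "y \<noteq> x" for y
    by (rule subst_tm_cong) (use Forall.prems[of y] that in auto)
  then have "(\<lambda>y. subst_tm (s'(x := Var x)) ((s(x := Var x)) y)) = (\<lambda>y. subst_tm s' (s y))(x := Var x)"
    by auto
  moreover have "subst (s'(x := Var x)) (subst (s(x := Var x)) F) =
      subst (\<lambda>y. subst_tm (s'(x := Var x)) ((s(x := Var x)) y)) F"
    by (rule Forall.IH) (use Forall.prems in auto)
  ultimately show ?case by simp
next
  case (Exists x F)
  have "subst_tm (s'(x := Var x)) (s y) = subst_tm s' (s y)" if "y \<noteq> x" for y
    by (rule subst_tm_cong) (use Exists.prems[of y] that in auto)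
  then have "(\<lambda>y. subst_tm (s'(x := Var x)) ((s(x := Var x)) y)) = (\<lambda>y. subst_tm s' (s y))(x := Var x)"
    by auto
  moreover have "subst (s'(x := Var x)) (subst (s(x := Var x)) F) =
      subst (\<lambda>y. subst_tm (s'(x := Var x)) ((s(x := Var x)) y)) F"
    by (rule Exists.IH) (use Exists.prems in auto)
  ultimately show ?case by simp
qed simp_all

text \<open>The quantifier clauses put a constant into the open body; read as an updated
  simultaneous substitution, the result falls under an induction hypothesis for arbitrary ground
  substitutions.\<close>

lemma subst1_subst_ground:
  assumes "\<And>x. fv_tm (s x) = {}"
  shows "subst1 x t (subst (s(x := Var x)) F) = subst (s(x := t)) F"
proof -
  have "subst_tm (Var(x := t)) ((s(x := Var x)) y) = (s(x := t)) y" for y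
    using assms[of y] by (cases "s y") auto
  then show ?thesis
    unfolding subst1_def using assms by (subst subst_subst) (auto simp: fun_upd_def)
qed

lemma fv_subst: "fv (subst s F) \<subseteq> (\<Union>x\<in>fv F. fv_tm (s x))"
proof (induction F arbitrary: s)
  case (Atom P ts)
  have "fv_tm (subst_tm s t) = (\<Union>x\<in>fv_tm t. fv_tm (s x))" for t
    by (cases t) auto
  then show ?case by simp
next
  case (Forall x F)
  have "fv (subst (s(x := Var x)) F) \<subseteq> (\<Union>y\<in>fv F. fv_tm ((s(x := Var x)) y))"
    by (rule Forall.IH)
  then show ?case by (fastforce split: if_splits)
next
  case (Exists x F)
  have "fv (subst (s(x := Var x)) F) \<subseteq> (\<Union>y\<in>fv F. fv_tm ((s(x := Var x)) y))"
    by (rule Exists.IH)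
  then show ?case by (fastforce split: if_splits)
qed (simp_all, blast+)

lemma fv_subst1_closed: "fv_tm t = {} \<Longrightarrow> fv (subst1 x t F) \<subseteq> fv F - {x}"
  using fv_subst[of "Var(x := t)" F] by (auto simp: subst1_def split: if_splits)

lemma set2_subst: "set2_fm (subst s F) \<subseteq> set2_fm F \<union> (\<Union>x. set_tm (s x))"
proof (induction F arbitrary: s)
  case (Atom P ts)
  have "set_tm (subst_tm s t) \<subseteq> set_tm t \<union> (\<Union>x. set_tm (s x))" for t
    by (cases t) auto
  then show ?case by (auto 4 4)
next
  case (Forall x F)
  have "set2_fm (subst (s(x := Var x)) F) \<subseteq> set2_fm F \<union> (\<Union>y. set_tm ((s(x := Var x)) y))"
    by (rule Forall.IH)
  then show ?case by (fastforce split: if_splits)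
next
  case (Exists x F)
  have "set2_fm (subst (s(x := Var x)) F) \<subseteq> set2_fm F \<union> (\<Union>y. set_tm ((s(x := Var x)) y))"
    by (rule Exists.IH)
  then show ?case by (fastforce split: if_splits)
qed (simp_all, blast+)

lemma subst1_fresh_inverse:
  fixes F :: "('p, 'c) fm"
  assumes "y \<notin> all_vars F" and "y \<noteq> x"
  shows "subst1 y (Var x) (subst1 x (Var y) F) = F"
proof -
  \<comment> \<open>Below a quantifier on \<open>x\<close> the substitution
    \<open>Var(x := Var y)\<close> collapses to \<open>Var\<close>, so the induction has to cover
    both.\<close>
  have "y \<notin> all_vars F \<Longrightarrow> s = Var \<or> s = Var(x := Var y) \<Longrightarrow> subst (Var(y := Var x)) (subst s F) = F"
    for s and F :: "('p, 'c) fm"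
  proof (induction F arbitrary: s)
    case (Atom P ts)
    have "subst_tm (Var(y := Var x)) (subst_tm s t) = t" if "t \<in> set ts" for t
    proof (cases t)
      case (Var z)
      then have "z \<noteq> y" using that Atom.prems(1) by auto
      then show ?thesis using Var Atom.prems(2) by auto
    qed simp
    then show ?case by (simp add: map_idI del: fun_upd_apply)
  next
    case (Forall z F)
    have "s(z := Var z) = Var \<or> s(z := Var z) = Var(x := Var y)" and "((Var :: nat \<Rightarrow> 'c tm)(y := Var x))(z := Var z) = Var(y := Var x)"
      using Forall.prems by (cases "z = x"; auto simp: fun_eq_iff)+
    then show ?case using Forall.IH[of "s(z := Var z)"] Forall.prems(1) by (simp del: fun_upd_apply)
  next
    case (Exists z F)
    have "s(z := Var z) = Var \<or> s(z := Var z) = Var(x := Var y)" and "((Var :: nat \<Rightarrow> 'c tm)(y := Var x))(z := Var z) = Var(y := Var x)"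
      using Exists.prems by (cases "z = x"; auto simp: fun_eq_iff)+
    then show ?case using Exists.IH[of "s(z := Var z)"] Exists.prems(1) by (simp del: fun_upd_apply)
  qed auto
  then show ?thesis using assms by (simp add: subst1_def)
qed

text \<open>Each \<open>y\<close> stands where \<open>x\<close> was free in \<open>F\<close>, hence
  under no quantifier on \<open>x\<close>.\<close>

lemma free_for_fresh_inverse:
  fixes F :: "('p, 'c) fm"
  assumes "y \<notin> all_vars F" and "y \<noteq> x"
  shows "free_for (Var x) y (subst1 x (Var y) F)"
proof -
  have "y \<notin> all_vars F \<Longrightarrow> s = Var \<or> s = Var(x := Var y) \<Longrightarrow> free_for (Var x) y (subst s F)"
    for s and F :: "('p, 'c) fm"
  proof (induction F arbitrary: s)
    case (Forall z F)
    show ?case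
    proof (cases "z = x")
      case True
      then have "s(z := Var z) = Var" using Forall.prems(2) by (auto simp: fun_eq_iff)
      moreover have "y \<notin> fv F" using Forall.prems(1) fv_subset_all_vars[of F] by auto
      ultimately show ?thesis by simp
    next
      case False
      then have "s(z := Var z) = s" using Forall.prems(2) by (auto simp: fun_eq_iff)
      then show ?thesis using Forall False by simp
    qed
  next
    case (Exists z F)
    show ?case
    proof (cases "z = x")
      case True
      then have "s(z := Var z) = Var" using Exists.prems(2) by (auto simp: fun_eq_iff)
      moreover have "y \<notin> fv F" using Exists.prems(1) fv_subset_all_vars[of F] by auto
      ultimately show ?thesis by simp
    next
      case False
      then have "s(z := Var z) = s" using Exists.prems(2) by (auto simp: fun_eq_iff)
      then show ?thesis using Exists False by simp
    qed
  qed auto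
  then show ?thesis using assms by (simp add: subst1_def)
qed

section \<open>Soundness\<close>

text \<open>An environment takes over the role of the constants naming domain elements: free
  variables get their values directly, and the quantifier clauses recurse on the body
  itself.\<close>

fun val :: "('p, 'c, 'a) struct \<Rightarrow> (nat \<Rightarrow> 'a) \<Rightarrow> 'c tm \<Rightarrow> 'a" where
  "val \<AA> e (Var x) = e x"
| "val \<AA> e (Cst c) = cint \<AA> c"

text \<open>The Boolean selects verification or falsification.\<close>

primrec sem :: "('p, 'c, 'a, 'w) model \<Rightarrow> ('p, 'c) fm \<Rightarrow> bool \<Rightarrow> 'w \<Rightarrow> (nat \<Rightarrow> 'a) \<Rightarrow> bool" where
  "sem M (Atom P ts) b w e \<longleftrightarrow>
     (let \<AA> = (if b then pos M w else neg M w) in map (val \<AA> e) ts \<in> pint \<AA> P)"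
| "sem M Bot b w e \<longleftrightarrow> \<not> b"
| "sem M (Imp F G) b w e \<longleftrightarrow>
     (if b then sem M F True w e \<longrightarrow> sem M G True w e else sem M F True w e \<and> sem M G False w e)"
| "sem M (And F G) b w e \<longleftrightarrow>
     (if b then sem M F True w e \<and> sem M G True w e else sem M F False w e \<or> sem M G False w e)"
| "sem M (Or F G) b w e \<longleftrightarrow>
     (if b then sem M F True w e \<or> sem M G True w e else sem M F False w e \<and> sem M G False w e)"
| "sem M (SNeg F) b w e \<longleftrightarrow> sem M F (\<not> b) w e"
| "sem M (Box F) b w e \<longleftrightarrow>
     (if b then \<forall>u. (w, u) \<in> acc M \<longrightarrow> sem M F True u e else \<exists>u. (w, u) \<in> acc M \<and> sem M F False u e)"
| "sem M (Dia F) b w e \<longleftrightarrow>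
     (if b then \<exists>u. (w, u) \<in> acc M \<and> sem M F True u e else \<forall>u. (w, u) \<in> acc M \<longrightarrow> sem M F False u e)"
| "sem M (Forall x F) b w e \<longleftrightarrow>
     (if b then \<forall>a\<in>carr (pos M w). sem M F True w (e(x := a))
      else \<exists>a\<in>carr (pos M w). sem M F False w (e(x := a)))"
| "sem M (Exists x F) b w e \<longleftrightarrow>
     (if b then \<exists>a\<in>carr (pos M w). sem M F True w (e(x := a))
      else \<forall>a\<in>carr (pos M w). sem M F False w (e(x := a)))"

lemma is_modelD:
  assumes "is_model \<sigma> M"
  shows "(u, v) \<in> acc M \<Longrightarrow> v \<in> worlds M"
    and "(u, v) \<in> acc M \<Longrightarrow> carr (pos M u) \<subseteq> carr (pos M v)"
    and "(u, v) \<in> acc M \<Longrightarrow> c \<in> csts \<sigma> \<Longrightarrow> cint (pos M v) c = cint (pos M u) c"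
    and "w \<in> worlds M \<Longrightarrow> c \<in> csts \<sigma> \<Longrightarrow> cint (neg M w) c = cint (pos M w) c"
    and "w \<in> worlds M \<Longrightarrow> c \<in> csts \<sigma> \<Longrightarrow> cint (pos M w) c \<in> carr (pos M w)"
  using assms unfolding is_model_def is_struct_def by (blast | fastforce)+

lemma ground_fv: "ground s \<Longrightarrow> fv_tm (s x) = {}"
  unfolding ground_def by (metis fv_tm.simps(2))

lemma ground_substE:
  assumes "ground s" and "is_subst \<sigma> A s"
  obtains c where "c \<in> csts \<sigma>" "s x = Cst (Inl c)" | a where "a \<in> A" "s x = Cst (Inr a)"
proof -
  obtain c where c: "s x = Cst c" using assms(1) by (auto simp: ground_def)
  moreover have "s x \<in> Tm (sig_ext \<sigma> A)" using assms(2) by (simp add: is_subst_def)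
  ultimately have "c \<in> Inl ` csts \<sigma> \<union> Inr ` A" by (auto simp: Tm_def sig_ext_def)
  then show ?thesis using c that by auto
qed

lemma is_subst_mono: "is_subst \<sigma> A s \<Longrightarrow> A \<subseteq> B \<Longrightarrow> is_subst \<sigma> B s"
  by (fastforce simp: is_subst_def Tm_def sig_ext_def)

text \<open>The environment is read off at \<open>w\<close>. It stays correct elsewhere because the
  negative structure interprets constants as the positive one does, and successors enlarge the
  domain without moving constants.\<close>

lemma verifies_iff_sem:
  assumes M: "is_model \<sigma> M" and "w \<in> worlds M" and "ground s" and "is_subst \<sigma> (carr (pos M w)) s"
    and "wf_fm \<sigma> F"
  shows "(verifies M w (subst s (lift F)) \<longleftrightarrow> sem M F True w (\<lambda>x. tm_val (pos M w) (s x))) \<and>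
    (falsifies M w (subst s (lift F)) \<longleftrightarrow> sem M F False w (\<lambda>x. tm_val (pos M w) (s x)))"
  using assms(2-)
proof (induction F arbitrary: w s)
  case (Atom P ts)
  have "tm_val (pos M w) (subst_tm s (map_tm Inl t)) = val (pos M w) (\<lambda>x. tm_val (pos M w) (s x)) t" for t
    by (cases t) auto
  moreover have "tm_val (neg M w) (subst_tm s (map_tm Inl t)) = val (neg M w) (\<lambda>x. tm_val (pos M w) (s x)) t" for t
  proof (cases t)
    case (Var x)
    then show ?thesis
      by (cases rule: ground_substE[OF Atom.prems(2,3), of x]) (use is_modelD(4)[OF M Atom.prems(1)] in auto)
  qed simp
  ultimately show ?case by (simp add: lift_def comp_def Let_def)
next
  case (Box F)
  have "is_subst \<sigma> (carr (pos M u)) s" if "(w, u) \<in> acc M" for u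
    using is_subst_mono Box.prems(3) is_modelD(2)[OF M that] .
  moreover have "tm_val (pos M u) (s x) = tm_val (pos M w) (s x)" if "(w, u) \<in> acc M" for u x
    by (rule ground_substE[OF Box.prems(2,3), of x]) (use is_modelD(3)[OF M that] in auto)
  ultimately show ?case
    using Box.IH Box.prems is_modelD(1)[OF M] by (auto simp: lift_def)
next
  case (Dia F)
  have "is_subst \<sigma> (carr (pos M u)) s" if "(w, u) \<in> acc M" for u
    using is_subst_mono Dia.prems(3) is_modelD(2)[OF M that] .
  moreover have "tm_val (pos M u) (s x) = tm_val (pos M w) (s x)" if "(w, u) \<in> acc M" for u x
    by (rule ground_substE[OF Dia.prems(2,3), of x]) (use is_modelD(3)[OF M that] in auto)
  ultimately show ?case
    using Dia.IH Dia.prems is_modelD(1)[OF M] by (auto simp: lift_def)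
next
  case (Forall x F)
  have "(\<lambda>y. tm_val (pos M w) ((s(x := Cst (Inr a))) y)) = (\<lambda>y. tm_val (pos M w) (s y))(x := a)" for a
    by auto
  moreover have "ground (s(x := Cst (Inr a)))" for a
    using Forall.prems(2) by (auto simp: ground_def)
  moreover have "is_subst \<sigma> (carr (pos M w)) (s(x := Cst (Inr a)))" if "a \<in> carr (pos M w)" for a
    using Forall.prems(3) that by (auto simp: is_subst_def Tm_def sig_ext_def)
  ultimately have "(verifies M w (subst (s(x := Cst (Inr a))) (lift F)) \<longleftrightarrow>
        sem M F True w ((\<lambda>y. tm_val (pos M w) (s y))(x := a))) \<and>
      (falsifies M w (subst (s(x := Cst (Inr a))) (lift F)) \<longleftrightarrow>
        sem M F False w ((\<lambda>y. tm_val (pos M w) (s y))(x := a)))" if "a \<in> carr (pos M w)" for a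
    using Forall.IH[of w "s(x := Cst (Inr a))"] Forall.prems(1,4) that by (simp del: fun_upd_apply)
  then show ?case
    by (simp add: lift_def subst1_subst_ground ground_fv[OF Forall.prems(2)] del: fun_upd_apply cong: conj_cong)
next
  case (Exists x F)
  have "(\<lambda>y. tm_val (pos M w) ((s(x := Cst (Inr a))) y)) = (\<lambda>y. tm_val (pos M w) (s y))(x := a)" for a
    by auto
  moreover have "ground (s(x := Cst (Inr a)))" for a
    using Exists.prems(2) by (auto simp: ground_def)
  moreover have "is_subst \<sigma> (carr (pos M w)) (s(x := Cst (Inr a)))" if "a \<in> carr (pos M w)" for a
    using Exists.prems(3) that by (auto simp: is_subst_def Tm_def sig_ext_def)
  ultimately have "(verifies M w (subst (s(x := Cst (Inr a))) (lift F)) \<longleftrightarrow>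
        sem M F True w ((\<lambda>y. tm_val (pos M w) (s y))(x := a))) \<and>
      (falsifies M w (subst (s(x := Cst (Inr a))) (lift F)) \<longleftrightarrow>
        sem M F False w ((\<lambda>y. tm_val (pos M w) (s y))(x := a)))" if "a \<in> carr (pos M w)" for a
    using Exists.IH[of w "s(x := Cst (Inr a))"] Exists.prems(1,4) that by (simp del: fun_upd_apply)
  then show ?case
    by (simp add: lift_def subst1_subst_ground ground_fv[OF Exists.prems(2)] del: fun_upd_apply cong: conj_cong)
qed (simp_all add: lift_def)

lemma val_cong: "(\<And>x. x \<in> fv_tm t \<Longrightarrow> e x = e' x) \<Longrightarrow> val \<AA> e t = val \<AA> e' t"
  by (cases t) auto

lemma sem_cong:
  fixes M :: "('p, 'c, 'a, 'w) model"
  shows "(\<And>x. x \<in> fv F \<Longrightarrow> e x = e' x) \<Longrightarrow> sem M F b w e \<longleftrightarrow> sem M F b w e'"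
proof (induction F arbitrary: b w e e')
  case (Atom P ts)
  have "map (val \<AA> e) ts = map (val \<AA> e') ts" for \<AA> :: "('p, 'c, 'a) struct"
    using Atom by (auto intro!: val_cong)
  then show ?case by (simp only: sem.simps Let_def)
next
  case (Imp F G)
  show ?case using Imp.IH[of e e'] Imp.prems by simp
next
  case (And F G)
  show ?case using And.IH[of e e'] And.prems by simp
next
  case (Or F G)
  show ?case using Or.IH[of e e'] Or.prems by simp
next
  case (SNeg F)
  show ?case using SNeg.IH[of e e'] SNeg.prems by simp
next
  case (Box F)
  show ?case using Box.IH[of e e'] Box.prems by simp
next
  case (Dia F)
  show ?case using Dia.IH[of e e'] Dia.prems by simp
next
  case (Forall x F)
  have "sem M F b w (e(x := a)) \<longleftrightarrow> sem M F b w (e'(x := a))" for a b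
    by (rule Forall.IH) (use Forall.prems in auto)
  then show ?case by simp
next
  case (Exists x F)
  have "sem M F b w (e(x := a)) \<longleftrightarrow> sem M F b w (e'(x := a))" for a b
    by (rule Exists.IH) (use Exists.prems in auto)
  then show ?case by simp
qed auto

lemma sem_fun_upd_not_free: "x \<notin> fv F \<Longrightarrow> sem M F b w (e(x := a)) \<longleftrightarrow> sem M F b w e"
  by (rule sem_cong) auto

lemma val_fun_upd: "x \<notin> fv_tm t \<Longrightarrow> val \<AA> (e(x := a)) t = val \<AA> e t"
  by (cases t) auto

text \<open>The modal cases require that \<open>t\<close> keeps its value along accessibility, which
  is the rigidity of the constants of \<sigma>; \<open>free_for\<close> protects \<open>t\<close>
  below quantifiers.\<close>

lemma sem_subst1:
  assumes M: "is_model \<sigma> M" and t: "t \<in> Tm \<sigma>"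
    and "w \<in> worlds M" and "free_for t x F"
  shows "sem M (subst1 x t F) b w e \<longleftrightarrow> sem M F b w (e(x := val (pos M w) e t))"
  using assms(3-)
proof (induction F arbitrary: b w e)
  case (Atom P ts)
  have "val (if b then pos M w else neg M w) e \<circ> subst_tm (Var(x := t)) =
      val (if b then pos M w else neg M w) (e(x := val (pos M w) e t))"
  proof
    fix t'
    show "(val (if b then pos M w else neg M w) e \<circ> subst_tm (Var(x := t))) t' =
        val (if b then pos M w else neg M w) (e(x := val (pos M w) e t)) t'"
      using is_modelD(4)[OF M Atom.prems(1)] t by (cases t'; cases t) (auto simp: Tm_def)
  qed
  then show ?case by (simp only: subst1_def subst.simps sem.simps Let_def map_map)
next
  case (Box F)
  have "val (pos M u) e t = val (pos M w) e t" if "(w, u) \<in> acc M" for u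
    using is_modelD(3)[OF M that] t by (cases t) (auto simp: Tm_def)
  then have "sem M (subst1 x t F) b u e \<longleftrightarrow> sem M F b u (e(x := val (pos M w) e t))" if "(w, u) \<in> acc M" for u b
    using Box.IH[OF is_modelD(1)[OF M that]] Box.prems that by (simp del: fun_upd_apply)
  then show ?case by (simp add: subst1_def del: fun_upd_apply cong: conj_cong)
next
  case (Dia F)
  have "val (pos M u) e t = val (pos M w) e t" if "(w, u) \<in> acc M" for u
    using is_modelD(3)[OF M that] t by (cases t) (auto simp: Tm_def)
  then have "sem M (subst1 x t F) b u e \<longleftrightarrow> sem M F b u (e(x := val (pos M w) e t))" if "(w, u) \<in> acc M" for u b
    using Dia.IH[OF is_modelD(1)[OF M that]] Dia.prems that by (simp del: fun_upd_apply)
  then show ?case by (simp add: subst1_def del: fun_upd_apply cong: conj_cong)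
next
  case (Forall y F)
  show ?case
  proof (cases "x \<in> fv (Forall y F)")
    case True
    then have "(Var(x := t))(y := Var y) = Var(x := t)" and "x \<noteq> y" and "y \<notin> fv_tm t" "free_for t x F"
      using Forall.prems by auto
    moreover from this have "sem M (subst1 x t F) b w (e(y := a)) \<longleftrightarrow>
        sem M F b w ((e(x := val (pos M w) e t))(y := a))" for a b
      using Forall.IH[OF Forall.prems(1)] by (simp add: val_fun_upd fun_upd_twist del: fun_upd_apply)
    ultimately show ?thesis by (simp add: subst1_def del: fun_upd_apply)
  next
    case False
    then show ?thesis
      by (simp only: subst1_not_free sem_fun_upd_not_free not_False_eq_True)
  qed
next
  case (Exists y F)
  show ?case
  proof (cases "x \<in> fv (Exists y F)")
    case True
    then have "(Var(x := t))(y := Var y) = Var(x := t)" and "x \<noteq> y" and "y \<notin> fv_tm t" "free_for t x F"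
      using Exists.prems by auto
    moreover from this have "sem M (subst1 x t F) b w (e(y := a)) \<longleftrightarrow>
        sem M F b w ((e(x := val (pos M w) e t))(y := a))" for a b
      using Exists.IH[OF Exists.prems(1)] by (simp add: val_fun_upd fun_upd_twist del: fun_upd_apply)
    ultimately show ?thesis by (simp add: subst1_def del: fun_upd_apply)
  next
    case False
    then show ?thesis
      by (simp only: subst1_not_free sem_fun_upd_not_free not_False_eq_True)
  qed
qed (auto simp: subst1_def)

text \<open>The side condition of the quantifier axioms does not mention \<sigma>. A term that
  really gets inserted shows up in the instance, whose well-formedness then puts it into
  \<open>Tm \<sigma>\<close>.\<close>

lemma wf_subst1_Tm: "x \<in> fv F \<Longrightarrow> wf_fm \<sigma> (subst1 x t F) \<Longrightarrow> t \<in> Tm \<sigma>"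
proof -
  have "\<lbrakk>x \<in> fv F; wf_fm \<sigma> (subst s F); s x = t\<rbrakk> \<Longrightarrow> t \<in> Tm \<sigma>" for s
  proof (induction F arbitrary: s)
    case (Atom P ts)
    then obtain t' where "t' \<in> set ts" "x \<in> fv_tm t'" by auto
    from \<open>x \<in> fv_tm t'\<close> have "t' = Var x" by (cases t') auto
    then show ?case using Atom.prems \<open>t' \<in> set ts\<close> by (auto simp: image_subset_iff)
  next
    case (Forall y F)
    then show ?case using Forall.IH[of "s(y := Var y)"] by auto
  next
    case (Exists y F)
    then show ?case using Exists.IH[of "s(y := Var y)"] by auto
  qed auto
  then show "x \<in> fv F \<Longrightarrow> wf_fm \<sigma> (subst1 x t F) \<Longrightarrow> t \<in> Tm \<sigma>"
    by (simp add: subst1_def)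
qed

lemma sem_instance:
  assumes M: "is_model \<sigma> M" and w: "w \<in> worlds M" and e: "range e \<subseteq> carr (pos M w)"
    and "free_for t x F" and "wf_fm \<sigma> (subst1 x t F)"
  shows "\<exists>a\<in>carr (pos M w). sem M (subst1 x t F) b w e \<longleftrightarrow> sem M F b w (e(x := a))"
proof (cases "x \<in> fv F")
  case True
  then have "t \<in> Tm \<sigma>" using wf_subst1_Tm assms(5) by blast
  then have "val (pos M w) e t \<in> carr (pos M w)"
    using is_modelD(5)[OF M w] e by (cases t) (auto simp: Tm_def)
  then show ?thesis using sem_subst1[OF M \<open>t \<in> Tm \<sigma>\<close> w assms(4)] by blast
next
  case False
  \<comment> \<open>Without a free occurrence of \<open>x\<close> the term may be foreign to
    \<sigma>; the current value \<open>e x\<close> serves as the element instead.\<close>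
  have "e x \<in> carr (pos M w)" and "e(x := e x) = e" using e by auto
  then show ?thesis using False by (metis subst1_not_free)
qed

lemma axiom_sound:
  assumes M: "is_model \<sigma> M" and w: "w \<in> worlds M" and e: "range e \<subseteq> carr (pos M w)"
    and "axiom F" and "wf_fm \<sigma> F"
  shows "sem M F True w e"
  using assms(4)
proof cases
  case (22 t x F)
  then show ?thesis using sem_instance[OF M w e, of t x F True] assms(5) by auto
next
  case (23 t x F)
  then show ?thesis using sem_instance[OF M w e, of t x F True] assms(5) by auto
qed auto

lemma range_fun_upd_subset: "range e \<subseteq> A \<Longrightarrow> a \<in> A \<Longrightarrow> range (e(x := a)) \<subseteq> A"
  by auto

text \<open>The world varies in the induction because \<open>MB\<close> and \<open>MD\<close> refer
  to successors; the environment stays admissible there since domains only grow along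
  \<open>acc\<close>.\<close>

lemma QBK_sound:
  assumes M: "is_model \<sigma> M" and "F \<in> QBK \<sigma>"
  shows "w \<in> worlds M \<Longrightarrow> range e \<subseteq> carr (pos M w) \<Longrightarrow> sem M F True w e"
  using assms(2)
proof (induction arbitrary: w e)
  case (Ax F)
  then show ?case using axiom_sound[OF M] by (auto simp: Form_def)
next
  case (MP F G)
  then show ?case by fastforce
next
  case (MB F G)
  have "sem M (Imp F G) True u e" if "(w, u) \<in> acc M" for u
    using MB.IH is_modelD(1,2)[OF M that] MB.prems by blast
  then show ?case by auto
next
  case (MD F G)
  have "sem M (Imp F G) True u e" if "(w, u) \<in> acc M" for u
    using MD.IH is_modelD(1,2)[OF M that] MD.prems by blast
  then show ?case by auto
next
  case (BR1 F G x)
  have "sem M (Imp F G) True w (e(x := a))" if "a \<in> carr (pos M w)" for a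
    using BR1.IH[OF BR1.prems(1) range_fun_upd_subset[OF BR1.prems(2) that]] .
  then show ?case using BR1.hyps(2) by (auto simp: sem_fun_upd_not_free)
next
  case (BR2 F G x)
  have "sem M (Imp F G) True w (e(x := a))" if "a \<in> carr (pos M w)" for a
    using BR2.IH[OF BR2.prems(1) range_fun_upd_subset[OF BR2.prems(2) that]] .
  then show ?case using BR2.hyps(2) by (auto simp: sem_fun_upd_not_free)
qed

text \<open>One world suffices, as no modal rule is applied to consequences of \<Gamma>. All
  environments are needed, as \<open>BR1\<close> and \<open>BR2\<close> change the value of a
  variable.\<close>

lemma consequences_sound:
  assumes M: "is_model \<sigma> M" and w: "w \<in> worlds M"
    and \<Gamma>: "\<Gamma> \<subseteq> Sent \<sigma>" and ver: "\<And>F e. F \<in> \<Gamma> \<Longrightarrow> range e \<subseteq> carr (pos M w) \<Longrightarrow> sem M F True w e"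
    and "F \<in> consequences \<sigma> \<Gamma>"
  shows "range e \<subseteq> carr (pos M w) \<Longrightarrow> sem M F True w e"
  using assms(5)
proof (induction arbitrary: e)
  case (base F)
  then show ?case using ver QBK_sound[OF M _ w] by blast
next
  case (MP F G)
  then show ?case by fastforce
next
  case (BR1 F G x)
  have "sem M (Imp F G) True w (e(x := a))" if "a \<in> carr (pos M w)" for a
    using BR1.IH[OF range_fun_upd_subset[OF BR1.prems that]] .
  then show ?case using BR1.hyps(2) by (auto simp: sem_fun_upd_not_free)
next
  case (BR2 F G x)
  have "sem M (Imp F G) True w (e(x := a))" if "a \<in> carr (pos M w)" for a
    using BR2.IH[OF range_fun_upd_subset[OF BR2.prems that]] .
  then show ?case using BR2.hyps(2) by (auto simp: sem_fun_upd_not_free)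
qed

lemma sem_disjunction: "sem M (disjunction Fs) True w e \<longleftrightarrow> (\<exists>F\<in>set Fs. sem M F True w e)"
  by (induction Fs rule: disjunction.induct) auto

lemma fv_map_fm: "fv (map_fm id f F) = fv F"
proof -
  have "fv_tm (map_tm f t) = fv_tm t" for t by (cases t) auto
  then show ?thesis by (induction F) auto
qed

lemma soundness:
  fixes \<sigma> :: "('p, 'c) signature"
  assumes \<Gamma>: "\<Gamma> \<subseteq> Sent \<sigma>" and \<Delta>: "\<Delta> \<subseteq> Form \<sigma>" and "derives \<sigma> \<Gamma> \<Delta>"
  shows "entails TYPE('a) TYPE('w) \<sigma> \<Gamma> \<Delta>"
  unfolding entails_def
proof (intro allI impI)
  fix M :: "('p, 'c, 'a, 'w) model" and w s
  assume M: "is_model \<sigma> M" and w: "w \<in> worlds M" and s: "is_subst \<sigma> (carr (pos M w)) s" "ground s"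
    and ver: "\<forall>F\<in>\<Gamma>. verifies M w (lift F)"
  define e where "e = (\<lambda>x. tm_val (pos M w) (s x))"
  have bridge: "verifies M w (subst s (lift F)) \<longleftrightarrow> sem M F True w e" if "F \<in> Form \<sigma>" for F
    using verifies_iff_sem[OF M w s(2,1), of F] that by (simp add: Form_def e_def)
  have "e x \<in> carr (pos M w)" for x
    by (rule ground_substE[OF s(2,1), of x]) (use is_modelD(5)[OF M w] in \<open>auto simp: e_def\<close>)
  then have e: "range e \<subseteq> carr (pos M w)" by blast
  \<comment> \<open>Members of \<Gamma> have no free variables, so truth in one environment spreads
    to all.\<close>
  have "sem M F True w e'" if "F \<in> \<Gamma>" for F e'
  proof -
    have F: "F \<in> Form \<sigma>" "fv F = {}" using that \<Gamma> by (auto simp: Sent_def)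
    then have "subst s (lift F) = lift F" by (simp add: subst_closed lift_def fv_map_fm)
    then have "sem M F True w e" using bridge[OF F(1)] ver that by simp
    then show ?thesis using sem_cong[of F e e' M True w] F(2) by simp
  qed
  moreover obtain Fs where Fs: "set Fs \<subseteq> \<Delta>" "disjunction Fs \<in> consequences \<sigma> \<Gamma>"
    using assms(3) by (auto simp: derives_def Disj_def)
  ultimately have "sem M (disjunction Fs) True w e"
    using consequences_sound[OF M w \<Gamma> _ _ e] by blast
  then show "\<exists>G\<in>\<Delta>. verifies M w (subst s (lift G))"
    using Fs(1) \<Delta> bridge unfolding sem_disjunction by blast
qed

section \<open>Replacing constants by variables\<close>

text \<open>With \<open>A = Form \<sigma>\<close> this is \<open>QBK \<sigma>\<close>; with \<open>A = UNIV\<close> no well-formedness has to be tracked.\<close>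

inductive prv :: "('p, 'c) fm set \<Rightarrow> ('p, 'c) fm \<Rightarrow> bool" for A where
  Ax: "axiom F \<Longrightarrow> F \<in> A \<Longrightarrow> prv A F"
| MP: "prv A F \<Longrightarrow> prv A (Imp F G) \<Longrightarrow> prv A G"
| MB: "prv A (Imp F G) \<Longrightarrow> prv A (Imp (Box F) (Box G))"
| MD: "prv A (Imp F G) \<Longrightarrow> prv A (Imp (Dia F) (Dia G))"
| BR1: "prv A (Imp F G) \<Longrightarrow> x \<notin> fv F \<Longrightarrow> prv A (Imp F (Forall x G))"
| BR2: "prv A (Imp F G) \<Longrightarrow> x \<notin> fv G \<Longrightarrow> prv A (Imp (Exists x F) G)"

lemma prv_Form_QBK: "prv (Form \<sigma>) F \<Longrightarrow> F \<in> QBK \<sigma>"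
  by (induction rule: prv.induct) (auto intro: QBK.intros)

primrec tr_tm :: "('c \<Rightarrow> 'd tm) \<Rightarrow> 'c tm \<Rightarrow> 'd tm" where
  "tr_tm \<kappa> (Var x) = Var x"
| "tr_tm \<kappa> (Cst c) = \<kappa> c"

text \<open>A derivation over \<open>UNIV\<close> may use unknown predicates or wrong arities.
  Sending such atoms to \<open>Bot\<close> removes them without leaving the axiom schemes; with
  \<open>ok\<close> constantly true only constants are replaced.\<close>

primrec tr :: "('p \<Rightarrow> nat \<Rightarrow> bool) \<Rightarrow> ('c \<Rightarrow> 'd tm) \<Rightarrow> ('p, 'c) fm \<Rightarrow> ('p, 'd) fm" where
  "tr ok \<kappa> (Atom P ts) = (if ok P (length ts) then Atom P (map (tr_tm \<kappa>) ts) else Bot)"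
| "tr ok \<kappa> Bot = Bot"
| "tr ok \<kappa> (Imp F G) = Imp (tr ok \<kappa> F) (tr ok \<kappa> G)"
| "tr ok \<kappa> (And F G) = And (tr ok \<kappa> F) (tr ok \<kappa> G)"
| "tr ok \<kappa> (Or F G) = Or (tr ok \<kappa> F) (tr ok \<kappa> G)"
| "tr ok \<kappa> (SNeg F) = SNeg (tr ok \<kappa> F)"
| "tr ok \<kappa> (Box F) = Box (tr ok \<kappa> F)"
| "tr ok \<kappa> (Dia F) = Dia (tr ok \<kappa> F)"
| "tr ok \<kappa> (Forall x F) = Forall x (tr ok \<kappa> F)"
| "tr ok \<kappa> (Exists x F) = Exists x (tr ok \<kappa> F)"

lemma fv_tr: "fv (tr ok \<kappa> F) \<subseteq> fv F \<union> (\<Union>c\<in>set2_fm F. fv_tm (\<kappa> c))"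
proof (induction F)
  case (Atom P ts)
  have "fv_tm (tr_tm \<kappa> t) \<subseteq> fv_tm t \<union> (\<Union>c\<in>set_tm t. fv_tm (\<kappa> c))" for t
    by (cases t) auto
  then show ?case by simp blast
qed auto

lemma tr_subst:
  assumes "\<And>c y. c \<in> set2_fm F \<Longrightarrow> y \<in> fv_tm (\<kappa> c) \<Longrightarrow> s y = Var y"
  shows "tr ok \<kappa> (subst s F) = subst (\<lambda>y. tr_tm \<kappa> (s y)) (tr ok \<kappa> F)"
  using assms
proof (induction F arbitrary: s)
  case (Atom P ts)
  have "tr_tm \<kappa> (subst_tm s t) = subst_tm (\<lambda>y. tr_tm \<kappa> (s y)) (tr_tm \<kappa> t)" if "t \<in> set ts" for t
  proof (cases t)
    case (Cst c)
    then have "subst_tm (\<lambda>y. tr_tm \<kappa> (s y)) (\<kappa> c) = subst_tm Var (\<kappa> c)"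
      by (intro subst_tm_cong) (use Atom.prems that in fastforce)
    then show ?thesis using Cst by simp
  qed simp
  then show ?case by auto
next
  case (Forall x F)
  have "tr ok \<kappa> (subst (s(x := Var x)) F) = subst (\<lambda>y. tr_tm \<kappa> ((s(x := Var x)) y)) (tr ok \<kappa> F)"
    by (rule Forall.IH) (use Forall.prems in auto)
  moreover have "(\<lambda>y. tr_tm \<kappa> ((s(x := Var x)) y)) = (\<lambda>y. tr_tm \<kappa> (s y))(x := Var x)" by auto
  ultimately show ?case by (simp del: fun_upd_apply)
next
  case (Exists x F)
  have "tr ok \<kappa> (subst (s(x := Var x)) F) = subst (\<lambda>y. tr_tm \<kappa> ((s(x := Var x)) y)) (tr ok \<kappa> F)"
    by (rule Exists.IH) (use Exists.prems in auto)
  moreover have "(\<lambda>y. tr_tm \<kappa> ((s(x := Var x)) y)) = (\<lambda>y. tr_tm \<kappa> (s y))(x := Var x)" by auto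
  ultimately show ?case by (simp del: fun_upd_apply)
qed auto

lemma tr_subst1:
  assumes "\<And>c. c \<in> set2_fm F \<Longrightarrow> x \<notin> fv_tm (\<kappa> c)"
  shows "tr ok \<kappa> (subst1 x t F) = subst1 x (tr_tm \<kappa> t) (tr ok \<kappa> F)"
proof -
  have "tr ok \<kappa> (subst (Var(x := t)) F) = subst (\<lambda>y. tr_tm \<kappa> ((Var(x := t)) y)) (tr ok \<kappa> F)"
    by (rule tr_subst) (use assms in fastforce)
  moreover have "(\<lambda>y. tr_tm \<kappa> ((Var(x := t)) y)) = Var(x := tr_tm \<kappa> t)" by auto
  ultimately show ?thesis by (simp only: subst1_def)
qed

text \<open>The variables introduced by \<open>\<kappa>\<close> avoid \<open>x\<close> and all
  variables of \<open>F\<close>: they create no new occurrence of \<open>x\<close> and no quantifier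
  of \<open>F\<close> captures them.\<close>

lemma free_for_tr:
  assumes "\<And>c. fv_tm (\<kappa> c) \<inter> insert x (all_vars F) = {}" and "free_for t x F"
  shows "free_for (tr_tm \<kappa> t) x (tr ok \<kappa> F)"
  using assms
proof (induction F)
  case (Forall y F)
  have "x \<notin> fv (tr ok \<kappa> (Forall y F))" if "x \<notin> fv (Forall y F)"
    using that fv_tr[of ok \<kappa> "Forall y F"] Forall.prems(1) by blast
  moreover have "y \<notin> fv_tm (tr_tm \<kappa> t)" if "y \<notin> fv_tm t"
    using that Forall.prems(1) by (cases t) auto
  ultimately show ?case
    using Forall by auto
next
  case (Exists y F)
  have "x \<notin> fv (tr ok \<kappa> (Exists y F))" if "x \<notin> fv (Exists y F)"
    using that fv_tr[of ok \<kappa> "Exists y F"] Exists.prems(1) by blast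
  moreover have "y \<notin> fv_tm (tr_tm \<kappa> t)" if "y \<notin> fv_tm t"
    using that Exists.prems(1) by (cases t) auto
  ultimately show ?case
    using Exists by auto
qed auto

lemma axiom_tr:
  assumes "axiom F" and "\<And>c. fv_tm (\<kappa> c) \<inter> all_vars F = {}"
  shows "axiom (tr ok \<kappa> F)"
  using assms(1)
proof cases
  case (22 t x G)
  then have "free_for (tr_tm \<kappa> t) x (tr ok \<kappa> G)"
    using assms(2) by (intro free_for_tr) auto
  then show ?thesis
    using 22 assms(2) axiom.intros(22)[of "tr_tm \<kappa> t" x "tr ok \<kappa> G"] by (simp add: tr_subst1)
next
  case (23 t x G)
  then have "free_for (tr_tm \<kappa> t) x (tr ok \<kappa> G)"
    using assms(2) by (intro free_for_tr) auto
  then show ?thesis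
    using 23 assms(2) axiom.intros(23)[of "tr_tm \<kappa> t" x "tr ok \<kappa> G"] by (simp add: tr_subst1)
qed (simp_all add: axiom.intros)

text \<open>The bound \<open>N\<close> exceeds every variable of the derivation, so no capture can occur.\<close>

lemma prv_tr:
  assumes "prv A F"
  shows "\<exists>N. \<forall>\<kappa> :: 'c \<Rightarrow> 'd tm. (\<forall>c. fv_tm (\<kappa> c) \<subseteq> {N..}) \<longrightarrow> (\<forall>F. tr ok \<kappa> F \<in> B) \<longrightarrow> prv B (tr ok \<kappa> F)"
  using assms
proof induction
  case (Ax F)
  obtain N where N: "\<And>x. x \<in> all_vars F \<Longrightarrow> x < N"
    using finite_nat_set_iff_bounded[THEN iffD1, OF finite_all_vars[of F]] by blast
  have "prv B (tr ok \<kappa> F)" if "\<forall>c. fv_tm (\<kappa> c) \<subseteq> {N..}" "\<forall>F. tr ok \<kappa> F \<in> B" for \<kappa> :: "'c \<Rightarrow> 'd tm"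
  proof -
    have "fv_tm (\<kappa> c) \<inter> all_vars F = {}" for c
      using N that(1) by fastforce
    then show ?thesis using that(2) by (intro prv.Ax axiom_tr[OF Ax(1)]) simp_all
  qed
  then show ?case by blast
next
  case (MP F G)
  then obtain N1 N2 where
    "\<And>\<kappa> :: 'c \<Rightarrow> 'd tm. (\<forall>c. fv_tm (\<kappa> c) \<subseteq> {N1..}) \<Longrightarrow> (\<forall>F. tr ok \<kappa> F \<in> B) \<Longrightarrow> prv B (tr ok \<kappa> F)"
    "\<And>\<kappa> :: 'c \<Rightarrow> 'd tm. (\<forall>c. fv_tm (\<kappa> c) \<subseteq> {N2..}) \<Longrightarrow> (\<forall>F. tr ok \<kappa> F \<in> B) \<Longrightarrow> prv B (tr ok \<kappa> (Imp F G))"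
    by blast
  moreover have "\<forall>c. fv_tm (\<kappa> c) \<subseteq> {N1..}" "\<forall>c. fv_tm (\<kappa> c) \<subseteq> {N2..}"
    if "\<forall>c. fv_tm (\<kappa> c) \<subseteq> {max N1 N2..}" for \<kappa> :: "'c \<Rightarrow> 'd tm"
    using that by fastforce+
  ultimately show ?case
    by (intro exI[of _ "max N1 N2"]) (metis prv.MP tr.simps(3))
next
  case (MB F G)
  from MB.IH show ?case
    by (elim ex_forward) (simp add: prv.MB)
next
  case (MD F G)
  from MD.IH show ?case
    by (elim ex_forward) (simp add: prv.MD)
next
  case (BR1 F G x)
  then obtain N where
    N: "\<And>\<kappa> :: 'c \<Rightarrow> 'd tm. (\<forall>c. fv_tm (\<kappa> c) \<subseteq> {N..}) \<Longrightarrow> (\<forall>F. tr ok \<kappa> F \<in> B) \<Longrightarrow> prv B (tr ok \<kappa> (Imp F G))"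
    by blast
  \<comment> \<open>From \<open>Suc x\<close> on no introduced variable equals \<open>x\<close>, so
    the side condition of \<open>BR1\<close> survives the translation.\<close>
  have "prv B (tr ok \<kappa> (Imp F (Forall x G)))"
    if "\<forall>c. fv_tm (\<kappa> c) \<subseteq> {max N (Suc x)..}" "\<forall>F. tr ok \<kappa> F \<in> B" for \<kappa> :: "'c \<Rightarrow> 'd tm"
  proof -
    have "x \<notin> fv (tr ok \<kappa> F)" using fv_tr[of ok \<kappa> F] BR1.hyps(2) that(1) by fastforce
    moreover have "prv B (tr ok \<kappa> (Imp F G))" by (rule N) (use that in fastforce)+
    ultimately show ?thesis by (simp add: prv.BR1)
  qed
  then show ?case by blast
next
  case (BR2 F G x)
  then obtain N where
    N: "\<And>\<kappa> :: 'c \<Rightarrow> 'd tm. (\<forall>c. fv_tm (\<kappa> c) \<subseteq> {N..}) \<Longrightarrow> (\<forall>F. tr ok \<kappa> F \<in> B) \<Longrightarrow> prv B (tr ok \<kappa> (Imp F G))"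
    by blast
  have "prv B (tr ok \<kappa> (Imp (Exists x F) G))"
    if "\<forall>c. fv_tm (\<kappa> c) \<subseteq> {max N (Suc x)..}" "\<forall>F. tr ok \<kappa> F \<in> B" for \<kappa> :: "'c \<Rightarrow> 'd tm"
  proof -
    have "x \<notin> fv (tr ok \<kappa> G)" using fv_tr[of ok \<kappa> G] BR2.hyps(2) that(1) by fastforce
    moreover have "prv B (tr ok \<kappa> (Imp F G))" by (rule N) (use that in fastforce)+
    ultimately show ?thesis by (simp add: prv.BR2)
  qed
  then show ?case by blast
qed

lemma tr_id:
  assumes "\<And>c. c \<in> set2_fm F \<Longrightarrow> \<kappa> c = Cst c"
  shows "tr (\<lambda>_ _. True) \<kappa> F = F"
  using assms
proof (induction F)
  case (Atom P ts)
  have "tr_tm \<kappa> t = t" if "t \<in> set ts" for t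
    using Atom that by (cases t) force+
  then show ?case by (simp add: map_idI)
qed auto

lemma tr_map_fm:
  assumes "wf_fm \<sigma> F" and "\<And>c. c \<in> csts \<sigma> \<Longrightarrow> \<kappa> (f c) = Cst c"
  shows "tr (\<lambda>P n. P \<in> preds \<sigma> \<and> n = arity \<sigma> P) \<kappa> (map_fm id f F) = F"
  using assms(1)
proof (induction F)
  case (Atom P ts)
  have "tr_tm \<kappa> (map_tm f t) = t" if "t \<in> set ts" for t
    using Atom that assms(2) by (cases t) (auto simp: Tm_def)
  then show ?case using Atom by (simp add: map_idI)
qed auto

lemma wf_tr:
  assumes "\<And>c. \<kappa> c \<in> Tm \<sigma>"
  shows "tr (\<lambda>P n. P \<in> preds \<sigma> \<and> n = arity \<sigma> P) \<kappa> F \<in> Form \<sigma>"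
proof -
  have "tr_tm \<kappa> t \<in> Tm \<sigma>" for t using assms by (cases t) (auto simp: Tm_def)
  then show ?thesis unfolding Form_def by (induction F) auto
qed

text \<open>Conservativity over \<sigma>: the derivation in the larger language is translated as a
  whole into one over \<open>Form \<sigma>\<close>, and the translation undoes \<open>f\<close> on
  the end formula.\<close>

lemma QBK_if_prv_map_fm:
  assumes "prv UNIV (map_fm id f F)" and "inj f" and "F \<in> Form \<sigma>"
  shows "F \<in> QBK \<sigma>"
proof -
  let ?ok = "\<lambda>P n. P \<in> preds \<sigma> \<and> n = arity \<sigma> P"
  obtain N where N: "\<And>\<kappa>. (\<forall>c. fv_tm (\<kappa> c) \<subseteq> {N..}) \<Longrightarrow> (\<forall>F. tr ?ok \<kappa> F \<in> Form \<sigma>) \<Longrightarrow>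
      prv (Form \<sigma>) (tr ?ok \<kappa> (map_fm id f F))"
    using prv_tr[OF assms(1)] by blast
  \<comment> \<open>Images of constants of \<sigma> are decoded. All other constants may share the
    single variable \<open>N\<close>, since \<open>prv_tr\<close> asks for no injectivity.\<close>
  define \<kappa> where "\<kappa> = (\<lambda>k. if k \<in> f ` csts \<sigma> then Cst (inv f k) else Var N)"
  have "prv (Form \<sigma>) (tr ?ok \<kappa> (map_fm id f F))"
    by (intro N allI wf_tr) (auto simp: \<kappa>_def Tm_def inv_f_f[OF assms(2)])
  moreover have "tr ?ok \<kappa> (map_fm id f F) = F"
    by (rule tr_map_fm) (use assms(3) in \<open>auto simp: \<kappa>_def Form_def inv_f_f[OF assms(2)]\<close>)
  ultimately show ?thesis using prv_Form_QBK by simp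
qed

section \<open>Generalization and the elimination of constants\<close>

lemma prv_generalize: "prv UNIV F \<Longrightarrow> prv UNIV (Forall x F)"
proof -
  assume "prv UNIV F"
  \<comment> \<open>A closed provable antecedent makes \<open>BR1\<close> applicable.\<close>
  then have "prv UNIV (Imp (Imp Bot Bot) F)"
    by (rule prv.MP) (rule prv.Ax[OF axiom.intros(1) UNIV_I])
  then have "prv UNIV (Imp (Imp Bot Bot) (Forall x F))" by (rule prv.BR1) simp
  then show ?thesis by (rule prv.MP[rotated]) (rule prv.Ax[OF axiom.intros(10) UNIV_I])
qed

text \<open>The constant is traded for a variable \<open>y\<close> beyond the whole derivation;
  generalizing over \<open>y\<close> and instantiating with \<open>x\<close> gives back
  \<open>F\<close>.\<close>

lemma prv_constant_elim:
  fixes F :: "('p, 'c) fm"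
  assumes "prv UNIV (subst1 x (Cst c) F)" and c: "c \<notin> set2_fm F"
  shows "prv UNIV F"
proof -
  obtain N where N: "\<And>\<kappa> :: 'c \<Rightarrow> 'c tm. (\<forall>c. fv_tm (\<kappa> c) \<subseteq> {N..}) \<Longrightarrow>
      prv UNIV (tr (\<lambda>_ _. True) \<kappa> (subst1 x (Cst c) F))"
    using prv_tr[OF assms(1), of "\<lambda>_ _. True" UNIV] by auto
  obtain L where L: "\<And>x. x \<in> all_vars F \<Longrightarrow> x < L"
    using finite_nat_set_iff_bounded[THEN iffD1, OF finite_all_vars[of F]] by blast
  define y where "y = Max {N, L, Suc x}"
  have y: "y \<ge> N" "y \<notin> all_vars F" "y \<noteq> x" using L[of y] by (auto simp: y_def)
  let ?\<kappa> = "Cst(c := Var y)"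
  have "prv UNIV (tr (\<lambda>_ _. True) ?\<kappa> (subst1 x (Cst c) F))"
    by (rule N) (use y in auto)
  moreover have "tr (\<lambda>_ _. True) ?\<kappa> (subst1 x (Cst c) F) = subst1 x (Var y) F"
    using c tr_id[of F ?\<kappa>] by (subst tr_subst1) (auto, metis)
  ultimately have "prv UNIV (Forall y (subst1 x (Var y) F))"
    using prv_generalize by simp
  moreover have "prv UNIV (Imp (Forall y (subst1 x (Var y) F)) (subst1 y (Var x) (subst1 x (Var y) F)))"
    by (intro prv.Ax axiom.intros free_for_fresh_inverse y UNIV_I)
  ultimately show ?thesis
    using y by (metis prv.MP subst1_fresh_inverse)
qed

text \<open>The constants are removed one at a time, over the finitely many free variables of
  \<open>F\<close>; injectivity of \<open>k\<close> keeps \<open>k x\<close> out of what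
  remains.\<close>

lemma prv_constants_elim:
  fixes F :: "('p, 'c) fm"
  assumes "prv UNIV (subst (\<lambda>x. Cst (k x)) F)" and "inj k" and "range k \<inter> set2_fm F = {}"
  shows "prv UNIV F"
proof -
  have "prv UNIV F" if "finite X" "prv UNIV (subst (\<lambda>x. if x \<in> X then Cst (k x) else Var x) F)" for X
    using that
  proof (induction X)
    case empty
    then show ?case by simp
  next
    case (insert x X)
    let ?s = "\<lambda>X x. if x \<in> X then Cst (k x) else Var x"
    have "subst1 x (Cst (k x)) (subst (?s X) F) = subst (?s (insert x X)) F"
      unfolding subst1_def by (subst subst_subst) (auto intro!: subst_cong simp: insert.hyps)
    moreover have "k x \<notin> set2_fm (subst (?s X) F)"
      using set2_subst[of "?s X" F] assms(2,3) insert.hyps(2)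
      by (fastforce split: if_splits dest: injD)
    ultimately have "prv UNIV (subst (?s X) F)"
      using prv_constant_elim insert.prems by metis
    then show ?case by (rule insert.IH)
  qed
  moreover have "subst (\<lambda>x. if x \<in> fv F then Cst (k x) else Var x) F = subst (\<lambda>x. Cst (k x)) F"
    by (rule subst_cong) simp
  ultimately show ?thesis using finite_fv assms(1) by metis
qed

section \<open>Maximal consistent sets\<close>

text \<open>Only modus ponens acts on the hypotheses; all other rules are confined to
  \<open>prv\<close>. Hence the deduction theorem needs no condition on free variables, and
  hypotheses are local to one world.\<close>

inductive der :: "('p, 'c) fm set \<Rightarrow> ('p, 'c) fm \<Rightarrow> bool" for T where
  hyp: "F \<in> T \<Longrightarrow> der T F"
| prv: "prv UNIV F \<Longrightarrow> der T F"
| mp: "der T F \<Longrightarrow> der T (Imp F G) \<Longrightarrow> der T G"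

lemma prv_axiom: "axiom F \<Longrightarrow> prv UNIV F"
  by (rule prv.Ax) simp_all

lemma der_axiom: "axiom F \<Longrightarrow> der T F"
  by (intro der.prv prv_axiom)

lemma der_mono: "der T F \<Longrightarrow> T \<subseteq> T' \<Longrightarrow> der T' F"
  by (induction rule: der.induct) (auto intro: der.intros)

lemma der_empty: "der {} F \<Longrightarrow> prv UNIV F"
  by (induction rule: der.induct) (auto intro: prv.MP)

lemma prv_Imp_refl: "prv UNIV (Imp F F)"
proof -
  have "prv UNIV (Imp (Imp F (Imp F F)) (Imp F F))"
    by (rule prv.MP[of _ "Imp F (Imp (Imp F F) F)"]) (intro prv_axiom axiom.intros)+
  then show ?thesis by (rule prv.MP[rotated]) (intro prv_axiom axiom.intros)
qed

lemma der_weaken: "der T F \<Longrightarrow> der T (Imp G F)"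
  by (erule der.mp) (intro der_axiom axiom.intros)

lemma deduction: "der (insert A T) B \<Longrightarrow> der T (Imp A B)"
proof (induction rule: der.induct)
  case (hyp F)
  then show ?case using prv_Imp_refl by (auto intro: der.prv der_weaken der.hyp)
next
  case (prv F)
  then show ?case by (intro der_weaken der.prv)
next
  case (mp F G)
  have "der T (Imp (Imp A (Imp F G)) (Imp (Imp A F) (Imp A G)))"
    by (intro der_axiom axiom.intros)
  then show ?case using mp.IH der.mp by blast
qed

lemma der_cut: "der T A \<Longrightarrow> der (insert A T) B \<Longrightarrow> der T B"
  using deduction der.mp by blast

lemma der_foldr: "der (set Fs \<union> T) F \<Longrightarrow> der T (foldr Imp Fs F)"
proof (induction Fs arbitrary: T)
  case (Cons G Fs)
  then have "der (insert G T) (foldr Imp Fs F)" by simp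
  then show ?case by (simp add: deduction)
qed simp

lemma der_foldrD: "der T (foldr Imp Fs F) \<Longrightarrow> set Fs \<subseteq> T \<Longrightarrow> der T F"
proof (induction Fs)
  case (Cons G Fs)
  then show ?case using der.mp[of T G "foldr Imp Fs F"] by (simp add: der.hyp)
qed simp

lemma der_finite: "der T F \<Longrightarrow> \<exists>S\<subseteq>T. finite S \<and> der S F"
proof (induction rule: der.induct)
  case (hyp F)
  then show ?case by (intro exI[of _ "{F}"]) (auto intro: der.hyp)
next
  case (prv F)
  then show ?case by (intro exI[of _ "{}"]) (auto intro: der.prv)
next
  case (mp F G)
  then obtain S1 S2 where "S1 \<subseteq> T" "finite S1" "der S1 F" "S2 \<subseteq> T" "finite S2" "der S2 (Imp F G)"
    by blast
  then show ?case
    by (intro exI[of _ "S1 \<union> S2"]) (auto intro: der.mp[of _ F] der_mono)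
qed

lemma der_listE:
  assumes "der T F"
  obtains Fs where "set Fs \<subseteq> T" and "prv UNIV (foldr Imp Fs F)"
proof -
  obtain S where "S \<subseteq> T" "finite S" "der S F" using der_finite[OF assms] by blast
  moreover then obtain Fs where "S = set Fs" using finite_list by blast
  ultimately show ?thesis using that[of Fs] der_foldr[of Fs "{}" F] by (simp add: der_empty)
qed

lemma der_efq: "der T Bot \<Longrightarrow> der T F"
  by (erule der.mp) (intro der_axiom axiom.intros)

lemma der_cases: "der (insert A T) B \<Longrightarrow> der (insert (Neg A) T) B \<Longrightarrow> der T B"
proof -
  assume "der (insert A T) B" "der (insert (Neg A) T) B"
  then have "der T (Imp A B)" "der T (Imp (Neg A) B)" by (auto intro: deduction)
  moreover have "der T (Imp (Imp A B) (Imp (Imp (Neg A) B) (Imp (Or A (Neg A)) B)))" "der T (Or A (Neg A))"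
    by (intro der_axiom axiom.intros)+
  ultimately show ?thesis using der.mp by blast
qed

lemma der_ccontr: "der (insert (Neg A) T) Bot \<Longrightarrow> der T A"
  by (rule der_cases[of A]) (auto intro: der.hyp der_efq)

section \<open>Lindenbaum sets and their closure properties\<close>

definition mcs :: "('p, 'c) fm set \<Rightarrow> bool" where
  "mcs w \<longleftrightarrow> \<not> der w Bot \<and> (\<forall>F. F \<in> w \<or> Neg F \<in> w)"

text \<open>Zorn's lemma on the consistent supersets of \<open>T\<close>: the union of a chain is
  consistent because a derivation uses finitely many hypotheses. Maximality decides every formula
  through \<open>der_cases\<close>.\<close>

lemma lindenbaum:
  assumes "\<not> der T Bot"
  obtains w where "T \<subseteq> w" and "mcs w"
proof -
  let ?A = "{w. T \<subseteq> w \<and> \<not> der w Bot}"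
  have "\<exists>w\<in>?A. \<forall>X\<in>?A. w \<subseteq> X \<longrightarrow> X = w"
  proof (rule subset_Zorn_nonempty)
    show "?A \<noteq> {}" using assms by blast
  next
    fix C assume C: "C \<noteq> {}" "subset.chain ?A C"
    have "\<not> der (\<Union>C) Bot"
    proof
      assume "der (\<Union>C) Bot"
      then obtain S where S: "S \<subseteq> \<Union>C" "finite S" "der S Bot" using der_finite by blast
      obtain w where "w \<in> C" "S \<subseteq> w" using finite_subset_Union_chain[OF S(2,1) C] by blast
      then have "der w Bot" using S(3) der_mono by blast
      then show False using \<open>w \<in> C\<close> C(2) by (auto simp: subset.chain_def)
    qed
    then show "\<Union>C \<in> ?A" using C by (fastforce simp: subset.chain_def)
  qed
  then obtain w where w: "T \<subseteq> w" "\<not> der w Bot" and "\<forall>X\<in>?A. w \<subseteq> X \<longrightarrow> X = w"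
    by (elim bexE CollectE conjE)
  then have max: "X = w" if "w \<subseteq> X" "\<not> der X Bot" for X
    using that by auto
  have "F \<in> w \<or> Neg F \<in> w" for F
    using max[of "insert F w"] max[of "insert (Neg F) w"] der_cases[of F w Bot] w(2) by blast
  then show ?thesis using that w by (simp add: mcs_def)
qed

context
  fixes w :: "('p, 'c) fm set"
  assumes w: "mcs w"
begin

lemma mcs_der: "der w F \<Longrightarrow> F \<in> w"
  using w der.mp[of w F Bot] by (auto simp: mcs_def intro: der.hyp)

lemma mcs_prv: "prv UNIV F \<Longrightarrow> F \<in> w"
  by (intro mcs_der der.prv)

lemma mcs_axiom: "axiom F \<Longrightarrow> F \<in> w"
  by (intro mcs_prv prv_axiom)

lemma mcs_mp: "Imp F G \<in> w \<Longrightarrow> F \<in> w \<Longrightarrow> G \<in> w"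
  using mcs_der der.mp der.hyp by blast

lemma mcs_Bot: "Bot \<notin> w"
  using w der.hyp by (auto simp: mcs_def)

lemma mcs_Imp: "Imp F G \<in> w \<longleftrightarrow> (F \<in> w \<longrightarrow> G \<in> w)"
proof
  assume "F \<in> w \<longrightarrow> G \<in> w"
  then consider "G \<in> w" | "Neg F \<in> w" using w by (auto simp: mcs_def)
  then show "Imp F G \<in> w"
  proof cases
    case 1
    then show ?thesis by (rule mcs_der[OF der_weaken[OF der.hyp]])
  next
    case 2
    then have "der (insert F w) Bot" using der.mp[of "insert F w" F Bot] by (auto intro: der.hyp)
    then show ?thesis by (rule mcs_der[OF deduction[OF der_efq]])
  qed
qed (use mcs_mp in blast)

lemma mcs_And: "And F G \<in> w \<longleftrightarrow> F \<in> w \<and> G \<in> w"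
  using mcs_axiom[OF axiom.intros(3)] mcs_axiom[OF axiom.intros(4)] mcs_axiom[OF axiom.intros(5)]
  by (meson mcs_mp)

lemma mcs_Or: "Or F G \<in> w \<longleftrightarrow> F \<in> w \<or> G \<in> w"
proof
  assume "Or F G \<in> w"
  moreover have "Imp (Imp F Bot) (Imp (Imp G Bot) (Imp (Or F G) Bot)) \<in> w"
    by (intro mcs_axiom axiom.intros)
  ultimately show "F \<in> w \<or> G \<in> w" by (auto simp: mcs_Imp mcs_Bot)
next
  show "F \<in> w \<or> G \<in> w \<Longrightarrow> Or F G \<in> w"
    using mcs_axiom[OF axiom.intros(6)] mcs_axiom[OF axiom.intros(7)] by (meson mcs_mp)
qed

lemmas mcs_simps = mcs_Bot mcs_Imp mcs_And mcs_Or

text \<open>The axioms push strong negation inwards, so membership of strongly negated formulas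
  obeys the falsification clauses.\<close>

lemma mcs_SNeg:
  "SNeg (SNeg F) \<in> w \<longleftrightarrow> F \<in> w"
  "SNeg (Imp F G) \<in> w \<longleftrightarrow> F \<in> w \<and> SNeg G \<in> w"
  "SNeg (Or F G) \<in> w \<longleftrightarrow> SNeg F \<in> w \<and> SNeg G \<in> w"
  "SNeg (And F G) \<in> w \<longleftrightarrow> SNeg F \<in> w \<or> SNeg G \<in> w"
  "SNeg Bot \<in> w"
  "SNeg (Forall x F) \<in> w \<longleftrightarrow> Exists x (SNeg F) \<in> w"
  "SNeg (Exists x F) \<in> w \<longleftrightarrow> Forall x (SNeg F) \<in> w"
proof -
  have iff: "A \<in> w \<longleftrightarrow> B \<in> w" if "axiom (Iff A B)" for A B
    using mcs_axiom[OF that] by (auto simp: mcs_And mcs_Imp)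
  show "SNeg (SNeg F) \<in> w \<longleftrightarrow> F \<in> w"
    by (intro iff axiom.intros)
  show "SNeg (Imp F G) \<in> w \<longleftrightarrow> F \<in> w \<and> SNeg G \<in> w"
    unfolding mcs_And[symmetric] by (intro iff axiom.intros)
  show "SNeg (Or F G) \<in> w \<longleftrightarrow> SNeg F \<in> w \<and> SNeg G \<in> w"
    unfolding mcs_And[symmetric] by (intro iff axiom.intros)
  show "SNeg (And F G) \<in> w \<longleftrightarrow> SNeg F \<in> w \<or> SNeg G \<in> w"
    unfolding mcs_Or[symmetric] by (intro iff axiom.intros)
  show "SNeg Bot \<in> w"
    by (intro mcs_axiom axiom.intros)
  show "SNeg (Forall x F) \<in> w \<longleftrightarrow> Exists x (SNeg F) \<in> w"
    by (intro iff axiom.intros)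
  show "SNeg (Exists x F) \<in> w \<longleftrightarrow> Forall x (SNeg F) \<in> w"
    by (intro iff axiom.intros)
qed

text \<open>The last two come from the second half of the \<open>SIff\<close> axioms, where a double
  strong negation cancels.\<close>

lemma mcs_modal:
  "Dia F \<in> w \<longleftrightarrow> Box (Neg F) \<notin> w"
  "SNeg (Box F) \<in> w \<longleftrightarrow> Dia (SNeg F) \<in> w"
  "SNeg (Dia F) \<in> w \<longleftrightarrow> Box (SNeg F) \<in> w"
proof -
  show "Dia F \<in> w \<longleftrightarrow> Box (Neg F) \<notin> w"
    using mcs_axiom[OF axiom.intros(19)[of F]] mcs_Bot unfolding mcs_Imp mcs_And by argo
  show "SNeg (Box F) \<in> w \<longleftrightarrow> Dia (SNeg F) \<in> w"
    using mcs_axiom[OF axiom.intros(20)[of F]] unfolding mcs_Imp mcs_And mcs_SNeg(1) by argo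
  show "SNeg (Dia F) \<in> w \<longleftrightarrow> Box (SNeg F) \<in> w"
    using mcs_axiom[OF axiom.intros(21)[of F]] unfolding mcs_Imp mcs_And mcs_SNeg(1) by argo
qed

lemma mcs_Forall_subst1: "Forall x F \<in> w \<Longrightarrow> subst1 x (Cst c) F \<in> w"
  by (rule mcs_mp[OF mcs_axiom[OF axiom.intros(22)]]) (simp_all add: free_for_closed)

lemma mcs_subst1_Exists: "subst1 x (Cst c) F \<in> w \<Longrightarrow> Exists x F \<in> w"
  by (rule mcs_mp[OF mcs_axiom[OF axiom.intros(23)]]) (simp_all add: free_for_closed)

lemma mcs_not_Forall: "Forall x F \<notin> w \<Longrightarrow> Exists x (Neg F) \<in> w"
proof -
  let ?E = "Exists x (Neg F)"
  have "axiom (Imp (Neg F) ?E)"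
    using axiom.intros(23)[OF free_for_Var_same, of x "Neg F"] by simp
  then have "der {Neg F, Neg ?E} ?E"
    by (rule der.mp[of _ "Neg F", OF der.hyp der_axiom, rotated]) simp
  then have "der {Neg F, Neg ?E} Bot" by (rule der.mp) (simp add: der.hyp)
  then have "der {} (Imp (Neg ?E) F)" by (rule deduction[OF der_ccontr])
  \<comment> \<open>The variable \<open>x\<close> is bound in \<open>?E\<close>, so
    \<open>BR1\<close> applies to this contrapositive form.\<close>
  then have "prv UNIV (Imp (Neg ?E) (Forall x F))" by (rule prv.BR1[OF der_empty]) simp
  from mcs_prv[OF this] show "Forall x F \<notin> w \<Longrightarrow> ?E \<in> w" using mcs_Bot unfolding mcs_Imp by argo
qed

end

text \<open>Normality: \<open>MB\<close> and the axiom joining two boxes under a conjunction give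
  the step from \<open>Box F\<close> and \<open>Box (Imp F G)\<close> to \<open>Box G\<close>.
  Reverse induction moves the last premise into the formula under the box.\<close>

lemma prv_Box_foldr:
  "prv UNIV (foldr Imp Fs G) \<Longrightarrow> prv UNIV (foldr Imp (map Box Fs) (Box G))"
proof (induction Fs arbitrary: G rule: rev_induct)
  case Nil
  \<comment> \<open>Necessitation is obtained from \<open>MB\<close>, since
    \<open>Box (Imp G G)\<close> is an axiom.\<close>
  then have "prv UNIV (Imp (Imp G G) G)"
    using prv.MP[OF _ prv_axiom[OF axiom.intros(1)]] by simp
  then have "prv UNIV (Imp (Box (Imp G G)) (Box G))" by (rule prv.MB)
  then show ?case using prv.MP[OF prv_axiom[OF axiom.intros(17)]] by simp
next
  case (snoc F Fs)
  let ?A = "And F (Imp F G)"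
  have "der {?A} F" and "der {?A} (Imp F G)"
    by (rule der.mp[of _ ?A, OF der.hyp der_axiom]; simp add: axiom.intros)+
  then have "prv UNIV (Imp ?A G)" by (intro der_empty deduction) (rule der.mp)
  then have K: "prv UNIV (Imp (Box (And F (Imp F G))) (Box G))" by (rule prv.MB)
  let ?T = "set (map Box (Fs @ [F]))"
  have "prv UNIV (foldr Imp (map Box Fs) (Box (Imp F G)))" using snoc by simp
  then have "der ?T (Box (Imp F G))" by (rule der_foldrD[OF der.prv]) auto
  moreover have "der ?T (Box F)" by (simp add: der.hyp)
  moreover have "der ?T (Imp (Box F) (Imp (Box (Imp F G)) (And (Box F) (Box (Imp F G)))))"
    and "der ?T (Imp (And (Box F) (Box (Imp F G))) (Box (And F (Imp F G))))"
    by (intro der_axiom axiom.intros)+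
  ultimately have "der ?T (Box G)" using der.prv[OF K] der.mp by metis
  then show ?case using der_foldr[of "map Box (Fs @ [F])" "{}"] by (simp add: der_empty)
qed

section \<open>Henkin constants\<close>

text \<open>\<open>Wit n x F\<close> is the witness of \<open>Exists x F\<close> introduced at level \<open>n\<close>; the nesting in \<open>F\<close> makes
  one round of witnesses per level sufficient. The constants \<open>Par x\<close> stand for the free variables
  of the succedent.\<close>

datatype ('p, 'c) hcon = Old 'c | Par nat | Wit nat nat "('p, ('p, 'c) hcon) fm"

text \<open>The level of a witness ignores the constants inside its formula. Thus every existential
  sentence, whatever its constants, has a witness of level \<open>Suc n\<close>.\<close>

primrec lev :: "('p, 'c) hcon \<Rightarrow> nat" where
  "lev (Old c) = 0"
| "lev (Par x) = 0"
| "lev (Wit n x F) = Suc n"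

definition bounded_sentence :: "nat \<Rightarrow> ('p, ('p, 'c) hcon) fm \<Rightarrow> bool" where
  "bounded_sentence n F \<longleftrightarrow> fv F = {} \<and> (\<forall>c\<in>set2_fm F. lev c \<le> n)"

lemma size_fm_set2: "c \<in> set2_fm F \<Longrightarrow> g c \<le> size_fm f g F"
proof (induction F)
  case (Atom P ts)
  then obtain t where "t \<in> set ts" "c \<in> set_tm t" by auto
  from \<open>c \<in> set_tm t\<close> have "g c \<le> size_tm g t" by (cases t) auto
  also have "\<dots> \<le> size_list (size_tm g) ts" using \<open>t \<in> set ts\<close> by (rule size_list_estimation') simp
  finally show ?case by simp
qed auto

text \<open>The nested datatype counts the constants of \<open>F\<close> in the size. This gives
  both the freshness of a witness for its own formula and the order in which Henkin axioms are
  added.\<close>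

lemma size_Wit: "c \<in> set2_fm F \<Longrightarrow> size c < size (Wit n x F)"
  using size_fm_set2[of c F size "\<lambda>_. 0"] by simp

lemma Wit_notin: "Wit n x F \<notin> set2_fm F"
  using size_Wit[of "Wit n x F" F n x] by auto

lemma foldr_Imp_simps:
  "fv (foldr Imp Fs G) = (\<Union>F\<in>set Fs. fv F) \<union> fv G"
  "set2_fm (foldr Imp Fs G) = (\<Union>F\<in>set Fs. set2_fm F) \<union> set2_fm G"
  "subst s (foldr Imp Fs G) = foldr Imp (map (subst s) Fs) (subst s G)"
  "map_fm id f (foldr Imp Fs G) = foldr Imp (map (map_fm id f) Fs) (map_fm id f G)"
  by (induction Fs) auto

text \<open>The finitely many premises used are moved into the succedent \<open>?G\<close>. As
  \<open>c\<close> and \<open>x\<close> are fresh for it, \<open>c\<close> can be turned back into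
  \<open>x\<close> and \<open>BR2\<close> binds it.\<close>

lemma der_witness:
  assumes "der (insert (subst1 x (Cst c) F) T) Bot" and "c \<notin> set2_fm F"
    and T: "\<And>G. G \<in> T \<Longrightarrow> c \<notin> set2_fm G \<and> x \<notin> fv G"
  shows "der (insert (Exists x F) T) Bot"
proof -
  let ?F = "subst1 x (Cst c) F"
  obtain Fs where Fs: "set Fs \<subseteq> T" "prv UNIV (foldr Imp Fs (Neg ?F))"
    using der_listE[OF deduction[OF assms(1)]] by blast
  let ?G = "foldr Imp Fs Bot"
  have G: "x \<notin> fv ?G" "c \<notin> set2_fm ?G" using T Fs(1) by (auto simp: foldr_Imp_simps)
  have "der (set Fs \<union> {?F}) (Neg ?F)"
    by (rule der_foldrD[OF der.prv[OF Fs(2)]]) auto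
  then have "der (set Fs \<union> {?F}) Bot" by (rule der.mp[rotated]) (simp add: der.hyp)
  then have "prv UNIV (Imp ?F ?G)" by (rule der_empty[OF deduction[OF der_foldr]])
  then have "prv UNIV (subst1 x (Cst c) (Imp F ?G))" using G by (simp add: subst1_not_free)
  then have "prv UNIV (Imp F ?G)" by (rule prv_constant_elim) (use assms(2) G in auto)
  then have "prv UNIV (Imp (Exists x F) ?G)" using G(1) by (rule prv.BR2)
  then have "der (insert (Exists x F) T) ?G"
    by (rule der.mp[OF der.hyp der.prv, rotated]) simp
  then show ?thesis by (rule der_foldrD) (use Fs(1) in auto)
qed

definition henkin :: "nat \<Rightarrow> nat \<times> ('p, ('p, 'c) hcon) fm \<Rightarrow> ('p, ('p, 'c) hcon) fm" where
  "henkin n = (\<lambda>(x, F). Imp (Exists x F) (subst1 x (Cst (Wit n x F)) F))"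

lemma fv_henkin: "fv F \<subseteq> {x} \<Longrightarrow> fv (henkin n (x, F)) = {}"
  using fv_subst1_closed[of "Cst (Wit n x F)" x F] by (auto simp: henkin_def)

lemma set2_henkin: "set2_fm (henkin n (x, F)) \<subseteq> insert (Wit n x F) (set2_fm F)"
  using set2_subst[of "Var(x := Cst (Wit n x F))" F] by (fastforce simp: henkin_def subst1_def split: if_splits)

text \<open>Both the instance and the negated existential imply the Henkin axiom. If
  \<open>T\<close> refutes that axiom, it refutes both, hence by \<open>der_witness\<close> also the
  existential itself.\<close>

lemma henkin_step:
  assumes "\<not> der T Bot" and "\<And>G. G \<in> T \<Longrightarrow> Wit n x F \<notin> set2_fm G \<and> x \<notin> fv G"
  shows "\<not> der (insert (henkin n (x, F)) T) Bot"
proof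
  let ?H = "henkin n (x, F)" and ?F = "subst1 x (Cst (Wit n x F)) F"
  assume H: "der (insert ?H T) Bot"
  have "der (insert ?F T) Bot"
  proof (rule der_cut[of _ ?H])
    show "der (insert ?F T) ?H" by (simp add: henkin_def der_weaken der.hyp)
  qed (auto intro: der_mono[OF H])
  then have "der (insert (Exists x F) T) Bot"
    using der_witness Wit_notin assms(2) by metis
  moreover have "der (insert (Neg (Exists x F)) T) Bot"
  proof (rule der_cut[of _ ?H])
    have "der (insert (Exists x F) (insert (Neg (Exists x F)) T)) Bot"
      by (rule der.mp[of _ "Exists x F"]) (simp_all add: der.hyp)
    then show "der (insert (Neg (Exists x F)) T) ?H"
      unfolding henkin_def prod.case by (rule deduction[OF der_efq])
  qed (auto intro: der_mono[OF H])
  ultimately have "der T Bot" by (rule der_cases)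
  with assms(1) show False ..
qed

lemma henkin_consistent:
  assumes "\<not> der T Bot" and T: "\<And>G. G \<in> T \<Longrightarrow> bounded_sentence n G"
  shows "\<not> der (T \<union> henkin n ` {(x, F). fv F \<subseteq> {x}}) Bot"
proof
  let ?P = "{(x, F). fv F \<subseteq> {x}}"
  assume "der (T \<union> henkin n ` ?P) Bot"
  from der_finite[OF this] obtain S where S: "S \<subseteq> T \<union> henkin n ` ?P" "finite S" "der S Bot"
    by (elim exE conjE)
  have "finite (S - T)" and "S - T \<subseteq> henkin n ` ?P" using S(1,2) by auto
  from finite_subset_image[OF this] obtain U where U: "finite U" "U \<subseteq> ?P" "S - T = henkin n ` U"
    by (elim exE conjE)
  have "\<not> der (T \<union> henkin n ` U) Bot"
    using U(1,2)
  \<comment> \<open>The pair added last has a witness of maximal size, which by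
    \<open>size_Wit\<close> occurs in none of the earlier formulas.\<close>
  proof (induction U rule: finite_ranking_induct[where f = "\<lambda>(x, F). size (Wit n x F)"])
    case empty
    then show ?case using assms(1) by simp
  next
    case (insert p U)
    obtain x F where p: "p = (x, F)" by fastforce
    show ?case
    proof (cases "p \<in> U")
      case True
      then show ?thesis using insert by (simp add: insert_absorb)
    next
      case False
      have "Wit n x F \<notin> set2_fm G \<and> x \<notin> fv G" if G: "G \<in> T \<union> henkin n ` U" for G
        using G
      proof
        \<comment> \<open>Constants of \<open>T\<close> have level at most \<open>n\<close>, whereas
          the witness has level \<open>Suc n\<close>.\<close>
        assume "G \<in> T"
        then show ?thesis using T[of G] by (fastforce simp: bounded_sentence_def)
      next
        assume "G \<in> henkin n ` U"
        then obtain y H where yH: "(y, H) \<in> U" "G = henkin n (y, H)" by auto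
        moreover from this have "fv H \<subseteq> {y}" using insert.prems by auto
        ultimately have "fv G = {}" using fv_henkin by simp
        moreover have "Wit n x F \<noteq> Wit n y H" using False p yH by auto
        moreover have "Wit n x F \<notin> set2_fm H"
          using size_Wit[of "Wit n x F" H n y] insert.hyps(2)[OF yH(1)] p by auto
        ultimately show ?thesis using set2_henkin[of n y H] yH(2) by auto
      qed
      then have "\<not> der (insert (henkin n (x, F)) (T \<union> henkin n ` U)) Bot"
        using insert by (intro henkin_step) auto
      then show ?thesis by (simp add: p)
    qed
  qed
  moreover have "S \<subseteq> T \<union> henkin n ` U" using U(3) by blast
  ultimately show False using S(3) der_mono by blast
qed

section \<open>Witnessed worlds and the existence of successors\<close>

definition world :: "nat \<Rightarrow> ('p, ('p, 'c) hcon) fm set \<Rightarrow> bool" where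
  "world n w \<longleftrightarrow> mcs w \<and>
     (\<forall>x F. fv F \<subseteq> {x} \<longrightarrow> Exists x F \<in> w \<longrightarrow> (\<exists>c. lev c \<le> Suc n \<and> subst1 x (Cst c) F \<in> w))"

lemma world_extension:
  assumes "\<not> der T Bot" and "\<And>G. G \<in> T \<Longrightarrow> bounded_sentence n G"
  obtains w where "T \<subseteq> w" and "world n w"
proof -
  obtain w where w: "T \<union> henkin n ` {(x, F). fv F \<subseteq> {x}} \<subseteq> w" "mcs w"
    using henkin_consistent[OF assms] lindenbaum by blast
  have "subst1 x (Cst (Wit n x F)) F \<in> w" if "fv F \<subseteq> {x}" "Exists x F \<in> w" for x F
  proof (rule mcs_mp[OF w(2) _ that(2)])
    show "Imp (Exists x F) (subst1 x (Cst (Wit n x F)) F) \<in> w"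
      using w(1) that(1) by (auto simp: henkin_def)
  qed
  moreover have "lev (Wit n x F) \<le> Suc n" for x and F :: "('a, ('a, 'b) hcon) fm" by simp
  ultimately have "world n w" unfolding world_def using w(2) by blast
  then show ?thesis using that w(1) by blast
qed

lemma world_Exists:
  assumes "world n w" and "fv F \<subseteq> {x}"
  shows "Exists x F \<in> w \<longleftrightarrow> (\<exists>c. lev c \<le> Suc n \<and> subst1 x (Cst c) F \<in> w)"
proof
  show "Exists x F \<in> w \<Longrightarrow> \<exists>c. lev c \<le> Suc n \<and> subst1 x (Cst c) F \<in> w"
    using assms by (simp add: world_def)
  show "\<exists>c. lev c \<le> Suc n \<and> subst1 x (Cst c) F \<in> w \<Longrightarrow> Exists x F \<in> w"
    using assms(1) by (auto simp: world_def intro: mcs_subst1_Exists)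
qed

lemma world_Forall:
  assumes "world n w" and "fv F \<subseteq> {x}"
  shows "Forall x F \<in> w \<longleftrightarrow> (\<forall>c. lev c \<le> Suc n \<longrightarrow> subst1 x (Cst c) F \<in> w)"
proof
  have w: "mcs w" using assms(1) by (simp add: world_def)
  show "Forall x F \<in> w \<Longrightarrow> \<forall>c. lev c \<le> Suc n \<longrightarrow> subst1 x (Cst c) F \<in> w"
    using mcs_Forall_subst1[OF w] by blast
  assume *: "\<forall>c. lev c \<le> Suc n \<longrightarrow> subst1 x (Cst c) F \<in> w"
  show "Forall x F \<in> w"
  proof (rule ccontr)
    assume "Forall x F \<notin> w"
    then obtain c where "lev c \<le> Suc n" "subst1 x (Cst c) (Neg F) \<in> w"
      using mcs_not_Forall[OF w] world_Exists[OF assms(1), of "Neg F" x] assms(2) by auto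
    then show False using * by (auto simp: mcs_simps[OF w])
  qed
qed

text \<open>Constants up to level \<open>Suc n\<close> form the domain at level \<open>n\<close>,
  and only boxed sentences about them are inherited. The witnesses for \<open>u\<close> may have
  level \<open>Suc (Suc n)\<close> and are fresh for what it inherits.\<close>

definition succ :: "nat \<Rightarrow> ('p, ('p, 'c) hcon) fm set \<Rightarrow> ('p, ('p, 'c) hcon) fm set \<Rightarrow> bool" where
  "succ n w u \<longleftrightarrow> world (Suc n) u \<and> (\<forall>F. bounded_sentence (Suc n) F \<longrightarrow> Box F \<in> w \<longrightarrow> F \<in> u)"

text \<open>If the unboxed sentences did not derive \<open>F\<close>, they would have with
  \<open>Neg F\<close> a witnessed extension, that is, a successor omitting \<open>F\<close>.
  Finitely many of them suffice for \<open>F\<close>, and normality restores the boxes.\<close>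

lemma world_Box:
  assumes "world n w" and F: "bounded_sentence (Suc n) F"
  shows "Box F \<in> w \<longleftrightarrow> (\<forall>u. succ n w u \<longrightarrow> F \<in> u)"
proof
  have w: "mcs w" using assms(1) by (simp add: world_def)
  show "Box F \<in> w \<Longrightarrow> \<forall>u. succ n w u \<longrightarrow> F \<in> u" using F by (simp add: succ_def)
  assume *: "\<forall>u. succ n w u \<longrightarrow> F \<in> u"
  let ?T = "{G. bounded_sentence (Suc n) G \<and> Box G \<in> w}"
  have "der (insert (Neg F) ?T) Bot"
  proof (rule ccontr)
    assume "\<not> der (insert (Neg F) ?T) Bot"
    moreover have "bounded_sentence (Suc n) G" if "G \<in> insert (Neg F) ?T" for G
      using that F by (auto simp: bounded_sentence_def)
    ultimately obtain u where u: "insert (Neg F) ?T \<subseteq> u" "world (Suc n) u"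
      by (rule world_extension)
    then have "F \<in> u" using * by (auto simp: succ_def)
    moreover have "mcs u" using u(2) by (simp add: world_def)
    ultimately show False using u(1) by (simp add: mcs_Imp mcs_Bot)
  qed
  then obtain Fs where Fs: "set Fs \<subseteq> ?T" "prv UNIV (foldr Imp Fs F)"
    by (rule der_listE[OF der_ccontr])
  then have "der w (Box F)"
    by (intro der_foldrD[OF der.prv[OF prv_Box_foldr[OF Fs(2)]]]) auto
  then show "Box F \<in> w" by (rule mcs_der[OF w])
qed

section \<open>Coding into formulas over the original signature\<close>

primrec code_tm :: "('p, 'c) fm tm \<Rightarrow> ('p, 'c) fm" where
  "code_tm (Var x) = Forall x Bot"
| "code_tm (Cst F) = SNeg F"

primrec code_list :: "('p, 'c) fm list \<Rightarrow> ('p, 'c) fm" where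
  "code_list [] = Bot"
| "code_list (F # Fs) = And F (code_list Fs)"

text \<open>Constants that are themselves formulas become subformulas. An atom turns into a
  conjunction starting with \<open>Atom P []\<close>, a genuine conjunction gets the first conjunct
  \<open>Bot\<close>, and so the two cannot be confused.\<close>

primrec flat :: "('p, ('p, 'c) fm) fm \<Rightarrow> ('p, 'c) fm" where
  "flat (Atom P ts) = And (Atom P []) (code_list (map code_tm ts))"
| "flat Bot = Bot"
| "flat (Imp F G) = Imp (flat F) (flat G)"
| "flat (And F G) = And Bot (And (flat F) (flat G))"
| "flat (Or F G) = Or (flat F) (flat G)"
| "flat (SNeg F) = SNeg (flat F)"
| "flat (Box F) = Box (flat F)"
| "flat (Dia F) = Dia (flat F)"
| "flat (Forall x F) = Forall x (flat F)"
| "flat (Exists x F) = Exists x (flat F)"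

lemma code_tm_inj: "inj code_tm"
proof (rule injI)
  show "t = t'" if "code_tm t = code_tm t'" for t t' :: "('p, 'c) fm tm"
    using that by (cases t; cases t') auto
qed

lemma code_list_inj: "code_list Fs = code_list Gs \<Longrightarrow> Fs = Gs"
proof (induction Fs arbitrary: Gs)
  case Nil
  then show ?case by (cases Gs) auto
next
  case (Cons F Fs)
  then show ?case by (cases Gs) auto
qed

lemma flat_inj: "flat F = flat G \<Longrightarrow> F = G"
proof (induction F arbitrary: G)
  case (Atom P ts)
  then show ?case
    by (cases G) (auto dest!: code_list_inj simp: inj_map_eq_map[OF code_tm_inj])
next
  case Bot
  then show ?case by (cases G) auto
next
  case (Imp F1 F2)
  from Imp.prems Imp.IH show ?case by (cases G) auto
next
  case (And F1 F2)
  from And.prems And.IH show ?case by (cases G) auto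
next
  case (Or F1 F2)
  from Or.prems Or.IH show ?case by (cases G) auto
next
  case (SNeg F)
  from SNeg.prems SNeg.IH show ?case by (cases G) auto
next
  case (Box F)
  from Box.prems Box.IH show ?case by (cases G) auto
next
  case (Dia F)
  from Dia.prems Dia.IH show ?case by (cases G) auto
next
  case (Forall x F)
  from Forall.prems Forall.IH show ?case by (cases G) auto
next
  case (Exists x F)
  from Exists.prems Exists.IH show ?case by (cases G) auto
qed

text \<open>Constants inside a witness are coded first, then \<open>flat\<close> removes the
  remaining nesting. The predicate symbol for \<open>Old\<close> is arbitrary: codes must be
  distinct, not well formed.\<close>

primrec enc :: "('p, 'c) hcon \<Rightarrow> ('p, 'c) fm" where
  "enc (Old c) = Atom undefined [Cst c]"
| "enc (Par x) = Forall x Bot"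
| "enc (Wit n x F) = Exists n (Exists x (flat (map_fm id enc F)))"

lemma enc_eqD: "enc c = enc d \<Longrightarrow> c = d"
proof (induction c arbitrary: d)
  case (Old c)
  then show ?case by (cases d) auto
next
  case (Par x)
  then show ?case by (cases d) auto
next
  case (Wit n x F)
  then obtain G where G: "d = Wit n x G" "flat (map_fm id enc F) = flat (map_fm id enc G)"
    by (cases d) auto
  have "F = G"
  \<comment> \<open>The induction hypothesis gives injectivity only at the constants of
    \<open>F\<close>, which calls for the pointwise form of injectivity of the map.\<close>
  proof (rule fm.inj_map_strong[of F G id id enc enc])
    show "map_fm id enc F = map_fm id enc G" using G(2) by (rule flat_inj)
  qed (use Wit.IH in auto)
  then show ?case using G(1) by simp
qed

lemma inj_enc: "inj enc"
  by (rule injI) (rule enc_eqD)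

definition code_fm :: "('p, ('p, 'c) hcon) fm \<Rightarrow> ('p, 'c) fm" where
  "code_fm F = flat (map_fm id enc F)"

lemma inj_code_fm: "inj code_fm"
  unfolding code_fm_def
  by (rule injI) (metis flat_inj fm.inj_map inj_enc inj_on_id injD)

text \<open>The tag \<open>SNeg\<close> keeps codes of members apart from the marker
  \<open>Forall n Bot\<close>, so level and set can both be recovered.\<close>

definition code_world :: "nat \<times> ('p, ('p, 'c) hcon) fm set \<Rightarrow> ('p, 'c) fm set" where
  "code_world = (\<lambda>(n, w). insert (Forall n Bot) (SNeg ` code_fm ` w))"

lemma inj_code_world: "inj code_world"
proof (rule injI, clarify)
  fix n m and w u :: "('p, ('p, 'c) hcon) fm set"
  assume eq: "code_world (n, w) = code_world (m, u)"
  have fst: "Forall k Bot \<in> code_world (n, w) \<longleftrightarrow> k = n" for n k and w :: "('p, ('p, 'c) hcon) fm set"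
    by (auto simp: code_world_def)
  have snd: "SNeg (code_fm F) \<in> code_world (n, w) \<longleftrightarrow> F \<in> w" for n F and w :: "('p, ('p, 'c) hcon) fm set"
    by (auto simp: code_world_def dest: injD[OF inj_code_fm])
  have "n = m" using eq fst by metis
  moreover have "w = u" using eq snd by (metis subsetI subset_antisym)
  ultimately show "n = m \<and> w = u" ..
qed

section \<open>Completeness\<close>

definition signed :: "bool \<Rightarrow> ('p, 'c) fm \<Rightarrow> ('p, 'c) fm" where
  "signed b F = (if b then F else SNeg F)"

text \<open>Positive and negative extensions are read off independently of each other, from
  \<open>Atom\<close> and from \<open>SNeg\<close> of it. The bound \<open>Suc n\<close> lets the
  domain include the witnesses introduced at level \<open>n\<close>.\<close>

definition canon_struct ::
  "('p, 'c) signature \<Rightarrow> bool \<Rightarrow> nat \<times> ('p, ('p, 'c) hcon) fm set \<Rightarrow> ('p, 'c, ('p, 'c) fm) struct" where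
  "canon_struct \<sigma> b = (\<lambda>(n, w).
     \<lparr>carr = enc ` {c. lev c \<le> Suc n},
      cint = (\<lambda>c. enc (Old c)),
      pint = (\<lambda>P. {map enc cs | cs. length cs = arity \<sigma> P \<and> (\<forall>c\<in>set cs. lev c \<le> Suc n) \<and>
                     signed b (Atom P (map Cst cs)) \<in> w})\<rparr>)"

definition canon :: "('p, 'c) signature \<Rightarrow> ('p, 'c, ('p, 'c) fm, ('p, 'c) fm set) model" where
  "canon \<sigma> =
     \<lparr>worlds = code_world ` {(n, w). world n w},
      acc = {(code_world (n, w), code_world (Suc n, u)) | n w u. world n w \<and> succ n w u},
      pos = (\<lambda>v. canon_struct \<sigma> True (inv code_world v)),
      neg = (\<lambda>v. canon_struct \<sigma> False (inv code_world v))\<rparr>"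

lemma canon_simps [simp]:
  "pos (canon \<sigma>) (code_world (n, w)) = canon_struct \<sigma> True (n, w)"
  "neg (canon \<sigma>) (code_world (n, w)) = canon_struct \<sigma> False (n, w)"
  "carr (canon_struct \<sigma> b (n, w)) = enc ` {c. lev c \<le> Suc n}"
  "cint (canon_struct \<sigma> b (n, w)) = (\<lambda>c. enc (Old c))"
  "code_world (n, w) \<in> worlds (canon \<sigma>) \<longleftrightarrow> world n w"
  by (auto simp: canon_def canon_struct_def inv_f_f[OF inj_code_world] inj_image_mem_iff[OF inj_code_world])

lemma canon_acc:
  assumes "world n w"
  shows "(code_world (n, w), v) \<in> acc (canon \<sigma>) \<longleftrightarrow> (\<exists>u. succ n w u \<and> v = code_world (Suc n, u))"
  using assms by (auto simp: canon_def dest!: injD[OF inj_code_world])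

lemma map_enc_in_pint:
  assumes "\<forall>c\<in>set cs. lev c \<le> Suc n" and "length cs = arity \<sigma> P"
  shows "map enc cs \<in> pint (canon_struct \<sigma> b (n, w)) P \<longleftrightarrow> signed b (Atom P (map Cst cs)) \<in> w"
  using assms by (auto simp: canon_struct_def inj_map_eq_map[OF inj_enc])

lemma is_model_canon:
  assumes "world n (w :: ('p, ('p, 'c) hcon) fm set)"
  shows "is_model (\<sigma> :: ('p, 'c) signature) (canon \<sigma>)"
proof -
  have str: "is_struct \<sigma> (canon_struct \<sigma> b (m, u))" for b m and u :: "('p, ('p, 'c) hcon) fm set"
  proof -
    \<comment> \<open>A parameter has level 0, so no domain is empty even if \<sigma> has no
      constants.\<close>
    have "\<exists>c :: ('p, 'c) hcon. lev c \<le> Suc m" by (rule exI[of _ "Par 0"]) simp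
    then show ?thesis unfolding is_struct_def by (auto simp: canon_struct_def simp del: enc.simps)
  qed
  have worlds: "\<exists>m u. v = code_world (m, u)" if "v \<in> worlds (canon \<sigma>)" for v
    using that by (auto simp: canon_def)
  have "worlds (canon \<sigma>) \<noteq> {}" using assms canon_simps(5)[of n w \<sigma>] by blast
  moreover have "acc (canon \<sigma>) \<subseteq> worlds (canon \<sigma>) \<times> worlds (canon \<sigma>)"
    by (auto simp: canon_def succ_def)
  moreover have "is_struct \<sigma> (pos (canon \<sigma>) v) \<and> is_struct \<sigma> (neg (canon \<sigma>) v) \<and>
      carr (pos (canon \<sigma>) v) = carr (neg (canon \<sigma>) v) \<and>
      (\<forall>c\<in>csts \<sigma>. cint (pos (canon \<sigma>) v) c = cint (neg (canon \<sigma>) v) c)" if "v \<in> worlds (canon \<sigma>)" for v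
    using worlds[OF that] str by auto
  moreover have "carr (pos (canon \<sigma>) v) \<subseteq> carr (pos (canon \<sigma>) v') \<and>
      (\<forall>c\<in>csts \<sigma>. cint (pos (canon \<sigma>) v) c = cint (pos (canon \<sigma>) v') c)" if "(v, v') \<in> acc (canon \<sigma>)" for v v'
  proof -
    obtain m u u' where "v = code_world (m, u)" "v' = code_world (Suc m, u')"
      using \<open>(v, v') \<in> acc (canon \<sigma>)\<close> by (auto simp: canon_def)
    then show ?thesis by auto
  qed
  ultimately show ?thesis unfolding is_model_def by (intro conjI ballI) (simp_all add: split_beta)
qed

section \<open>Instances by constants and the truth lemma\<close>

definition inst :: "(nat \<Rightarrow> ('p, 'c) hcon) \<Rightarrow> ('p, 'c) fm \<Rightarrow> ('p, ('p, 'c) hcon) fm" where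
  "inst k F = subst (\<lambda>x. Cst (k x)) (map_fm id Old F)"

lemma inst_simps [simp]:
  "inst k Bot = Bot"
  "inst k (Imp F G) = Imp (inst k F) (inst k G)"
  "inst k (And F G) = And (inst k F) (inst k G)"
  "inst k (Or F G) = Or (inst k F) (inst k G)"
  "inst k (SNeg F) = SNeg (inst k F)"
  "inst k (Box F) = Box (inst k F)"
  "inst k (Dia F) = Dia (inst k F)"
  by (simp_all add: inst_def)

lemma bounded_sentence_inst:
  assumes "\<And>x. lev (k x) \<le> n"
  shows "bounded_sentence n (inst k F)"
proof -
  have "set2_fm (inst k F) \<subseteq> range Old \<union> range k"
    using set2_subst[of "\<lambda>x. Cst (k x)" "map_fm id Old F"] by (auto simp: inst_def fm.set_map)
  moreover have "fv (inst k F) = {}"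
    using fv_subst[of "\<lambda>x. Cst (k x)" "map_fm id Old F"] by (simp add: inst_def)
  ultimately show ?thesis using assms by (fastforce simp: bounded_sentence_def)
qed

text \<open>The body keeps \<open>x\<close> open; filling it with a constant amounts to updating
  \<open>k\<close>, so an induction hypothesis for arbitrary \<open>k\<close> covers the
  instances.\<close>

lemma inst_quantifier:
  obtains G where "inst k (Forall x F) = Forall x G" and "inst k (Exists x F) = Exists x G"
    and "fv G \<subseteq> {x}" and "\<And>c. subst1 x (Cst c) G = inst (k(x := c)) F"
proof
  let ?G = "subst ((\<lambda>x. Cst (k x))(x := Var x)) (map_fm id Old F)"
  show "inst k (Forall x F) = Forall x ?G" and "inst k (Exists x F) = Exists x ?G"
    by (simp_all add: inst_def)
  show "fv ?G \<subseteq> {x}"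
    using fv_subst[of "(\<lambda>x. Cst (k x))(x := Var x)" "map_fm id Old F"] by (fastforce split: if_splits)
  have "(\<lambda>y. Cst (k y))(x := Cst c) = (\<lambda>y. Cst ((k(x := c)) y))" for c by auto
  then show "subst1 x (Cst c) ?G = inst (k(x := c)) F" for c
    unfolding inst_def by (subst subst1_subst_ground) (simp_all only: fv_tm.simps)
qed

text \<open>Both signs are treated at once because \<open>SNeg\<close> exchanges them. The bound on
  \<open>k\<close> says that its values lie in the domain at level \<open>n\<close>; it persists at
  level \<open>Suc n\<close>, as the modal cases require.\<close>

lemma truth:
  assumes "world n w" and "wf_fm \<sigma> F" and "\<And>x. lev (k x) \<le> Suc n"
  shows "sem (canon \<sigma>) F b (code_world (n, w)) (\<lambda>x. enc (k x)) \<longleftrightarrow> signed b (inst k F) \<in> w"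
  using assms
proof (induction F arbitrary: n w k b)
  case (Atom P ts)
  \<comment> \<open>This is the constant denoted by a term, before coding.\<close>
  define val_hcon where "val_hcon = case_tm k Old"
  have "inst k (Atom P ts) = Atom P (map Cst (map val_hcon ts))"
    by (auto simp: inst_def val_hcon_def split: tm.split)
  moreover have "map (val (canon_struct \<sigma> b (n, w)) (\<lambda>x. enc (k x))) ts = map enc (map val_hcon ts)"
    by (auto simp: val_hcon_def split: tm.split)
  moreover have "\<forall>c\<in>set (map val_hcon ts). lev c \<le> Suc n"
    using Atom.prems(3) by (auto simp: val_hcon_def split: tm.split)
  moreover have "length (map val_hcon ts) = arity \<sigma> P" using Atom.prems(2) by simp
  ultimately have "map (val (canon_struct \<sigma> b (n, w)) (\<lambda>x. enc (k x))) ts \<in> pint (canon_struct \<sigma> b (n, w)) P \<longleftrightarrow>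
      signed b (inst k (Atom P ts)) \<in> w"
    using map_enc_in_pint[of "map val_hcon ts" n \<sigma> P b w] by (simp only:)
  then show ?case by (cases b) (simp_all add: Let_def)
next
  case Bot
  then have "mcs w" by (simp add: world_def)
  then show ?case by (simp add: signed_def mcs_Bot mcs_SNeg)
next
  case (Imp F G)
  then have w: "mcs w" by (simp add: world_def)
  show ?case using Imp.IH[of n w k] Imp.prems by (simp add: signed_def mcs_Imp[OF w] mcs_SNeg[OF w])
next
  case (And F G)
  then have w: "mcs w" by (simp add: world_def)
  show ?case using And.IH[of n w k] And.prems by (simp add: signed_def mcs_And[OF w] mcs_SNeg[OF w])
next
  case (Or F G)
  then have w: "mcs w" by (simp add: world_def)
  show ?case using Or.IH[of n w k] Or.prems by (simp add: signed_def mcs_Or[OF w] mcs_SNeg[OF w])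
next
  case (SNeg F)
  then have w: "mcs w" by (simp add: world_def)
  show ?case using SNeg.IH[of n w k] SNeg.prems by (simp add: signed_def mcs_SNeg[OF w])
next
  case (Box F)
  have w: "mcs w" using Box.prems by (simp add: world_def)
  have bd: "bounded_sentence (Suc n) (inst k F)" using bounded_sentence_inst Box.prems(3) .
  have IH: "sem (canon \<sigma>) F b (code_world (Suc n, u)) (\<lambda>x. enc (k x)) \<longleftrightarrow> signed b (inst k F) \<in> u"
    if "succ n w u" for u b
    using that Box.prems(2) le_SucI[OF Box.prems(3)] by (intro Box.IH) (auto simp: succ_def)
  have mu: "mcs u" if "succ n w u" for u using that by (simp add: succ_def world_def)
  show ?case
  proof (cases b)
    case True
    then show ?thesis
      using IH[where b = True] world_Box[OF Box.prems(1) bd]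
      by (auto simp: signed_def canon_acc[OF Box.prems(1)])
  next
    case False
    \<comment> \<open>Falsification of a box is membership of \<open>Dia (SNeg _)\<close>, which is
      treated as the failure of a box over \<open>Neg (SNeg _)\<close>.\<close>
    have "bounded_sentence (Suc n) (Neg (SNeg (inst k F)))" using bd by (simp add: bounded_sentence_def)
    from world_Box[OF Box.prems(1) this] have "Dia (SNeg (inst k F)) \<in> w \<longleftrightarrow> (\<exists>u. succ n w u \<and> SNeg (inst k F) \<in> u)"
      using mu by (auto simp: mcs_modal(1)[OF w] mcs_Imp mcs_Bot)
    then show ?thesis
      using False IH[where b = False]
      by (auto simp: signed_def canon_acc[OF Box.prems(1)] mcs_modal(2)[OF w])
  qed
next
  case (Dia F)
  have w: "mcs w" using Dia.prems by (simp add: world_def)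
  have bd: "bounded_sentence (Suc n) (inst k F)" using bounded_sentence_inst Dia.prems(3) .
  have IH: "sem (canon \<sigma>) F b (code_world (Suc n, u)) (\<lambda>x. enc (k x)) \<longleftrightarrow> signed b (inst k F) \<in> u"
    if "succ n w u" for u b
    using that Dia.prems(2) le_SucI[OF Dia.prems(3)] by (intro Dia.IH) (auto simp: succ_def)
  have mu: "mcs u" if "succ n w u" for u using that by (simp add: succ_def world_def)
  show ?case
  proof (cases b)
    case True
    have "bounded_sentence (Suc n) (Neg (inst k F))" using bd by (simp add: bounded_sentence_def)
    from world_Box[OF Dia.prems(1) this] have "Dia (inst k F) \<in> w \<longleftrightarrow> (\<exists>u. succ n w u \<and> inst k F \<in> u)"
      using mu by (auto simp: mcs_modal(1)[OF w] mcs_Imp mcs_Bot)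
    then show ?thesis
      using True IH[where b = True]
      by (auto simp: signed_def canon_acc[OF Dia.prems(1)])
  next
    case False
    have "bounded_sentence (Suc n) (SNeg (inst k F))" using bd by (simp add: bounded_sentence_def)
    from world_Box[OF Dia.prems(1) this] show ?thesis
      using False IH[where b = False]
      by (auto simp: signed_def canon_acc[OF Dia.prems(1)] mcs_modal(3)[OF w])
  qed
next
  case (Forall x F)
  have w: "mcs w" using Forall.prems by (simp add: world_def)
  obtain G where G1: "inst k (Forall x F) = Forall x G" "inst k (Exists x F) = Exists x G" and G2: "fv G \<subseteq> {x}"
    and inst: "\<And>c. subst1 x (Cst c) G = inst (k(x := c)) F"
    by (rule inst_quantifier[of k x F]) (rule that)
  have "(\<lambda>y. enc (k y))(x := enc c) = (\<lambda>y. enc ((k(x := c)) y))" for c by auto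
  then have IH: "sem (canon \<sigma>) F b (code_world (n, w)) ((\<lambda>y. enc (k y))(x := enc c)) \<longleftrightarrow> signed b (subst1 x (Cst c) G) \<in> w"
    if "lev c \<le> Suc n" for c b
    unfolding inst using that Forall.prems by (simp only:) (intro Forall.IH, auto)
  \<comment> \<open>Falsification turns into the dual quantifier over \<open>SNeg G\<close>, whose
    witness property is needed as well.\<close>
  have G': "fv (SNeg G) \<subseteq> {x}" using G2 by simp
  show ?case
    using IH by (auto simp: signed_def G1 mcs_SNeg[OF w] world_Forall[OF Forall.prems(1) G2]
        world_Exists[OF Forall.prems(1) G'] simp del: fun_upd_apply)
next
  case (Exists x F)
  have w: "mcs w" using Exists.prems by (simp add: world_def)
  obtain G where G1: "inst k (Forall x F) = Forall x G" "inst k (Exists x F) = Exists x G" and G2: "fv G \<subseteq> {x}"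
    and inst: "\<And>c. subst1 x (Cst c) G = inst (k(x := c)) F"
    by (rule inst_quantifier[of k x F]) (rule that)
  have "(\<lambda>y. enc (k y))(x := enc c) = (\<lambda>y. enc ((k(x := c)) y))" for c by auto
  then have IH: "sem (canon \<sigma>) F b (code_world (n, w)) ((\<lambda>y. enc (k y))(x := enc c)) \<longleftrightarrow> signed b (subst1 x (Cst c) G) \<in> w"
    if "lev c \<le> Suc n" for c b
    unfolding inst using that Exists.prems by (simp only:) (intro Exists.IH, auto)
  have G': "fv (SNeg G) \<subseteq> {x}" using G2 by simp
  show ?case
    using IH by (auto simp: signed_def G1 mcs_SNeg[OF w] world_Exists[OF Exists.prems(1) G2]
        world_Forall[OF Exists.prems(1) G'] simp del: fun_upd_apply)
qed

section \<open>From an inconsistent set back to a derivation\<close>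

lemma QBK_prv: "F \<in> QBK \<sigma> \<Longrightarrow> prv UNIV F"
  by (induction rule: QBK.induct) (auto intro: prv.intros)

lemma der_cut_set: "der S F \<Longrightarrow> (\<And>G. G \<in> S \<Longrightarrow> der T G) \<Longrightarrow> der T F"
  by (induction rule: der.induct) (auto intro: der.intros)

lemma der_disjunctionI: "F \<in> set Fs \<Longrightarrow> der T F \<Longrightarrow> der T (disjunction Fs)"
proof (induction Fs rule: disjunction.induct)
  case (3 F' G Fs)
  have "der T (Imp F' (Or F' (disjunction (G # Fs))))" "der T (Imp (disjunction (G # Fs)) (Or F' (disjunction (G # Fs))))"
    by (intro der_axiom axiom.intros)+
  then show ?case using 3 der.mp by (metis disjunction.simps(3) set_ConsD)
qed auto

lemma der_disjunction:
  assumes "der (T \<union> Neg ` set Fs) Bot"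
  shows "der T (disjunction Fs)"
proof (rule der_ccontr, rule der_cut_set[OF assms])
  let ?T = "insert (Neg (disjunction Fs)) T"
  fix G assume "G \<in> T \<union> Neg ` set Fs"
  then consider "G \<in> T" | F where "F \<in> set Fs" "G = Neg F" by blast
  then show "der ?T G"
  proof cases
    case 2
    then have "der (insert F ?T) (disjunction Fs)" by (intro der_disjunctionI) (auto intro: der.hyp)
    then have "der (insert F ?T) Bot" by (rule der.mp) (simp add: der.hyp)
    then show ?thesis using 2 by (simp add: deduction)
  qed (simp add: der.hyp)
qed

lemma wf_disjunction: "wf_fm \<sigma> (disjunction Fs) \<longleftrightarrow> (\<forall>F\<in>set Fs. wf_fm \<sigma> F)"
  by (induction Fs rule: disjunction.induct) auto

lemma wf_foldr_Imp: "wf_fm \<sigma> (foldr Imp Fs G) \<longleftrightarrow> (\<forall>F\<in>set Fs. wf_fm \<sigma> F) \<and> wf_fm \<sigma> G"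
  by (induction Fs) auto

lemma consequences_foldr_Imp:
  "foldr Imp Fs G \<in> consequences \<sigma> \<Gamma> \<Longrightarrow> set Fs \<subseteq> \<Gamma> \<Longrightarrow> G \<in> consequences \<sigma> \<Gamma>"
proof (induction Fs)
  case (Cons F Fs)
  then show ?case using consequences.MP[of F \<sigma> \<Gamma> "foldr Imp Fs G"] by (simp add: consequences.base)
qed simp

text \<open>A refutation uses finitely many formulas. Its parameters are turned back into variables,
  the negated members of \<Delta> are gathered into one disjunction, and the members of \<Gamma> are
  discharged by \<open>MP\<close>.\<close>

lemma derives_if_inconsistent:
  fixes \<sigma> :: "('p, 'c) signature"
  assumes \<Gamma>: "\<Gamma> \<subseteq> Form \<sigma>" and \<Delta>: "\<Delta> \<subseteq> Form \<sigma>" and inc: "der (inst Par ` (\<Gamma> \<union> Neg ` \<Delta>)) Bot"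
  shows "derives \<sigma> \<Gamma> \<Delta>"
proof -
  obtain Gs where Gs: "set Gs \<subseteq> inst Par ` (\<Gamma> \<union> Neg ` \<Delta>)" "prv UNIV (foldr Imp Gs Bot)"
    by (rule der_listE[OF inc])
  then have "Gs \<in> lists (inst Par ` (\<Gamma> \<union> Neg ` \<Delta>))" by auto
  then obtain Fs where Fs: "set Fs \<subseteq> \<Gamma> \<union> Neg ` \<Delta>" "Gs = map (inst Par) Fs"
    unfolding lists_image by auto
  let ?F = "foldr Imp Fs Bot"
  have "foldr Imp Gs Bot = inst Par ?F"
    unfolding Fs(2) inst_def foldr_Imp_simps by (simp add: comp_def inst_def)
  then have "prv UNIV (subst (\<lambda>x. Cst (Par x)) (map_fm id Old ?F :: ('p, ('p, 'c) hcon) fm))"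
    using Gs(2) by (simp add: inst_def)
  \<comment> \<open>Parameters are pairwise distinct and absent from the embedded formula, so they
    can be replaced by the variables they stand for.\<close>
  then have "prv UNIV (map_fm id Old ?F :: ('p, ('p, 'c) hcon) fm)"
    by (rule prv_constants_elim) (auto simp: inj_def fm.set_map)
  moreover have "?F \<in> Form \<sigma>" using Fs(1) \<Gamma> \<Delta> by (fastforce simp: Form_def wf_foldr_Imp)
  ultimately have "?F \<in> QBK \<sigma>" by (intro QBK_if_prv_map_fm) (auto simp: inj_def)
  then have der: "der (set Fs) Bot"
    by (intro der_foldrD[OF der.prv[OF QBK_prv]]) auto
  \<comment> \<open>A premise may belong to \<Gamma> and also be the negation of a member of
    \<Delta>; only premises outside \<Gamma> are traced back to \<Delta>.\<close>
  have "finite (set Fs - \<Gamma>)" "set Fs - \<Gamma> \<subseteq> Neg ` \<Delta>" using Fs(1) by auto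
  from finite_subset_image[OF this] obtain D where D: "D \<subseteq> \<Delta>" "finite D" "set Fs - \<Gamma> = Neg ` D"
    by (elim exE conjE)
  obtain Ds where Ds: "set Ds = D" using finite_list[OF D(2)] by blast
  have "der (\<Gamma> \<union> Neg ` set Ds) Bot"
    by (rule der_mono[OF der]) (use D(3) Ds in blast)
  then obtain Es where Es: "set Es \<subseteq> \<Gamma>" "prv UNIV (foldr Imp Es (disjunction Ds))"
    by (rule der_listE[OF der_disjunction])
  have "foldr Imp Es (disjunction Ds) \<in> Form \<sigma>"
    using Es(1) \<Gamma> \<Delta> D(1) Ds by (auto simp: Form_def wf_foldr_Imp wf_disjunction)
  \<comment> \<open>The regrouping took place in \<open>prv UNIV\<close>; conservativity with the
    identity embedding leads back to \<sigma>.\<close>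
  then have "foldr Imp Es (disjunction Ds) \<in> QBK \<sigma>"
    using Es(2) by (intro QBK_if_prv_map_fm[of id]) (simp_all add: fm.map_id)
  then have "disjunction Ds \<in> consequences \<sigma> \<Gamma>"
    using consequences_foldr_Imp[OF consequences.base Es(1)] by blast
  then show ?thesis using D(1) Ds by (auto simp: derives_def Disj_def)
qed

lemma completeness:
  fixes \<sigma> :: "('p, 'c) signature"
  assumes \<Gamma>: "\<Gamma> \<subseteq> Sent \<sigma>" and \<Delta>: "\<Delta> \<subseteq> Form \<sigma>"
    and ent: "entails TYPE(('p, 'c) fm) TYPE(('p, 'c) fm set) \<sigma> \<Gamma> \<Delta>"
  shows "derives \<sigma> \<Gamma> \<Delta>"
proof (rule derives_if_inconsistent, goal_cases)
  case 1
  show ?case using \<Gamma> by (auto simp: Sent_def)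
next
  case 2
  show ?case using \<Delta> .
next
  case 3
  show ?case
  proof (rule ccontr)
    let ?T = "inst Par ` (\<Gamma> \<union> Neg ` \<Delta>)"
    assume "\<not> der ?T Bot"
    \<comment> \<open>Only \<open>Old\<close> constants and parameters occur, all of level 0, so the
      extension can start at level 0.\<close>
    moreover have "bounded_sentence 0 G" if "G \<in> ?T" for G
      using that by (auto intro!: bounded_sentence_inst simp del: inst_simps)
    ultimately obtain w where w: "?T \<subseteq> w" "world 0 w"
      by (rule world_extension)
    let ?M = "canon \<sigma>" and ?v = "code_world (0, w)"
    \<comment> \<open>Each variable is sent to the name of its own parameter, so that satisfaction
      under \<open>s\<close> becomes membership of \<open>inst Par F\<close>.\<close>
    define s :: "nat \<Rightarrow> ('c + ('p, 'c) fm) tm" where "s x = Cst (Inr (enc (Par x)))" for x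
    have M: "is_model \<sigma> ?M" using is_model_canon[OF w(2)] .
    have v: "?v \<in> worlds ?M" using w(2) by simp
    have s: "ground s" "is_subst \<sigma> (carr (pos ?M ?v)) s"
      by (auto simp: ground_def s_def is_subst_def Tm_def sig_ext_def simp del: enc.simps)
    have ver: "verifies ?M ?v (subst s (lift F)) \<longleftrightarrow> inst Par F \<in> w" if "F \<in> Form \<sigma>" for F
      using verifies_iff_sem[OF M v s, of F] truth[OF w(2), of \<sigma> F Par True] that
      by (simp add: Form_def s_def signed_def)
    have "verifies ?M ?v (lift F)" if "F \<in> \<Gamma>" for F
    proof -
      have F: "F \<in> Form \<sigma>" "fv F = {}" using that \<Gamma> by (auto simp: Sent_def)
      then have "subst s (lift F) = lift F" by (simp add: subst_closed lift_def fv_map_fm)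
      then show ?thesis using ver[OF F(1)] w(1) that by auto
    qed
    then obtain G where G: "G \<in> \<Delta>" "verifies ?M ?v (subst s (lift G))"
      using ent M v s unfolding entails_def by blast
    then have "inst Par G \<in> w" using ver \<Delta> by blast
    moreover have "inst Par (Neg G) \<in> w" using w(1) G(1) by blast
    moreover have "mcs w" using w(2) by (simp add: world_def)
    ultimately show False by (simp add: mcs_Imp mcs_Bot)
  qed
qed

theorem theorem15:
  fixes \<sigma> :: "('p, 'c) signature"
    and \<Gamma> \<Delta> :: "('p, 'c) fm set"
  assumes "\<Gamma> \<subseteq> Sent \<sigma>" and "\<Delta> \<subseteq> Form \<sigma>"
  shows "(derives \<sigma> \<Gamma> \<Delta> \<longleftrightarrow> entails TYPE(('p, 'c) fm) TYPE(('p, 'c) fm set) \<sigma> \<Gamma> \<Delta>) \<and>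
         (derives \<sigma> \<Gamma> \<Delta> \<longrightarrow> entails TYPE('a) TYPE('w) \<sigma> \<Gamma> \<Delta>)"
  using soundness[OF assms, where 'a = "('p, 'c) fm" and 'w = "('p, 'c) fm set"]
    soundness[OF assms, where 'a = 'a and 'w = 'w] completeness[OF assms]
  by blast

end
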